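(* Let $\Lambda_1,\dots,\Lambda_s$ be lattices in $K^d$. Then their convex hull $\mathrm{conv}(\Lambda_1,\dots,\Lambda_s)$ is isomorphic to a tropical polytope in $\mathbb{TP}^{N}$, where $N\le d\cdot 2^d\cdot (d!)^{s-3}-1$.
   Context: Setting: $K$ is a field with a discrete valuation $\mathrm{val}:K\to\mathbb Z\cup\{\infty\}$, $R$ is its valuation ring and $\pi$ a uniformizer. A lattice is an $R$-submodule of $K^d$ generated by $d$ linearly independent vectors. Lattices $\Lambda,\Lambda'$ are equivalent if $\Lambda=c\Lambda'$ for some $c\in K^*$; $[\Lambda]$ is the class of $\Lambda$. Two classes are adjacent if they have representatives with $\pi\Lambda\subseteq\Lambda'\subseteq\Lambda$. The affine building $\mathcal B_d$ of $SL_d(K)$ is the flag simplicial complex whose vertices are lattice classes and whose edges join adjacent (distinct) classes. A set of lattice classes is convex if it is closed under taking intersections of finitely many representatives. The convex hull $\mathrm{conv}(\Lambda_1,\dots,\Lambda_s)$ is the smallest convex set of lattice classes containing $[\Lambda_1],\dots,[\Lambda_s]$, regarded as an induced subcomplex of $\mathcal B_d$. Tropical conventions: $\mathbb T=(\mathbb R\cup\{\infty\},\oplus,\odot)$ with $a\oplus b=\min(a,b)$, $a\odot b=a+b$. The tropical projective space is $\mathbb{TP}^{n-1}=(\mathbb T^n\setminus\{(\infty,\dots,\infty)\})/\mathbb R(1,\dots,1)$. The tropical distance is $d_{tr}(v,w)=\max_{i<j}|v_i-v_j+w_j-w_i|$. The tropical polytope spanned by points $p^{(1)},\dots,p^{(m)}$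 is the set of all $\lambda_1\odot p^{(1)}\oplus\dots\oplus\lambda_m\odot p^{(m)}$ with $\lambda_i\in\mathbb T$ (not all $\infty$); it is a tropical lattice polytope if all $p^{(i)}$ are images of points of $\mathbb Z^n$. The standard triangulation of $\mathbb{TP}^{n-1}$ is the flag simplicial complex on the integral points (images of $\mathbb Z^n$) with an edge between two integral points at tropical distance $1$; it restricts to a standard triangulation of any tropical lattice polytope. "Isomorphic to a tropical polytope" means isomorphic, as a simplicial complex, to the standard triangulation of a tropical lattice polytope.
   Formalization: The bound on N is claimed only for s ≥ 3; for s = 1, 2 only the isomorphism is claimed. With a negative exponent the bound fails: for s = 2, d = 5 it forces N = 0, but the hull of two distinct classes has at least two vertices. *)

theory Defs
  imports "HOL-Analysis.Analysis"
begin

section \<open>Discrete valuations\<close>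

text \<open>
  Values lie in \<open>\<int> \<union> {\<infinity>}\<close>, seen inside \<^typ>\<open>ereal\<close>. The trivial valuation satisfies this
  predicate, but it has no uniformizer in the sense below. The value group need not be all of
  \<open>\<int>\<close>, so a uniformizer is a nonzero generator of the maximal ideal rather than an element
  of value 1.
\<close>

definition discrete_valuation :: "('k::field \<Rightarrow> ereal) \<Rightarrow> bool" where
  "discrete_valuation v \<longleftrightarrow>
     (\<forall>x. v x = \<infinity> \<longleftrightarrow> x = 0) \<and>
     (\<forall>x. x \<noteq> 0 \<longrightarrow> (\<exists>n::int. v x = ereal (of_int n))) \<and>
     (\<forall>x y. v (x * y) = v x + v y) \<and>
     (\<forall>x y. min (v x) (v y) \<le> v (x + y))"

definition valuation_ring :: "('k::field \<Rightarrow> ereal) \<Rightarrow> 'k set" where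
  "valuation_ring v = {x. 0 \<le> v x}"

definition uniformizer :: "('k::field \<Rightarrow> ereal) \<Rightarrow> 'k \<Rightarrow> bool" where
  "uniformizer v \<pi> \<longleftrightarrow> \<pi> \<noteq> 0 \<and> {x. 0 < v x} = (\<lambda>r. \<pi> * r) ` valuation_ring v"


section \<open>Abstract simplicial complexes\<close>

text \<open>
  A simplicial complex is given by the set of its nonempty faces; its vertex set is the union of
  all faces.
\<close>

definition flag_complex :: "'v set \<Rightarrow> ('v \<Rightarrow> 'v \<Rightarrow> bool) \<Rightarrow> 'v set set" where
  "flag_complex V E =
     {\<sigma>. finite \<sigma> \<and> \<sigma> \<noteq> {} \<and> \<sigma> \<subseteq> V \<and> (\<forall>x\<in>\<sigma>. \<forall>y\<in>\<sigma>. x \<noteq> y \<longrightarrow> E x y)}"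

definition induced_subcomplex :: "'v set set \<Rightarrow> 'v set \<Rightarrow> 'v set set" where
  "induced_subcomplex \<Delta> W = {\<sigma> \<in> \<Delta>. \<sigma> \<subseteq> W}"

definition simplicial_isomorphic :: "'v set set \<Rightarrow> 'w set set \<Rightarrow> bool" where
  "simplicial_isomorphic \<Delta> \<Gamma> \<longleftrightarrow>
     (\<exists>f. bij_betw f (\<Union>\<Delta>) (\<Union>\<Gamma>) \<and> (\<forall>\<sigma>\<subseteq>\<Union>\<Delta>. \<sigma> \<in> \<Delta> \<longleftrightarrow> f ` \<sigma> \<in> \<Gamma>))"


section \<open>Lattices and the affine building\<close>

definition is_lattice :: "('k::field \<Rightarrow> ereal) \<Rightarrow> ('k ^ 'd) set \<Rightarrow> bool" where
  "is_lattice v L \<longleftrightarrow>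
     (\<exists>B. finite B \<and> card B = CARD('d) \<and> vec.independent B \<and>
          L = {(\<Sum>b\<in>B. c b *s b) | c. \<forall>b\<in>B. c b \<in> valuation_ring v})"

definition scale_set :: "'k::field \<Rightarrow> ('k ^ 'd) set \<Rightarrow> ('k ^ 'd) set" where
  "scale_set c L = (\<lambda>x. c *s x) ` L"

definition lattice_rel :: "('k::field \<Rightarrow> ereal) \<Rightarrow> (('k ^ 'd) set \<times> ('k ^ 'd) set) set" where
  "lattice_rel v =
     {(L, L'). is_lattice v L \<and> is_lattice v L' \<and> (\<exists>c. c \<noteq> 0 \<and> L = scale_set c L')}"

definition lattice_class :: "('k::field \<Rightarrow> ereal) \<Rightarrow> ('k ^ 'd) set \<Rightarrow> ('k ^ 'd) set set" where
  "lattice_class v L = lattice_rel v `` {L}"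

definition lattice_classes :: "('k::field \<Rightarrow> ereal) \<Rightarrow> ('k ^ 'd) set set set" where
  "lattice_classes v = {L. is_lattice v L} // lattice_rel v"

definition adjacent_classes ::
    "'k::field \<Rightarrow> ('k ^ 'd) set set \<Rightarrow> ('k ^ 'd) set set \<Rightarrow> bool" where
  "adjacent_classes \<pi> X Y \<longleftrightarrow>
     X \<noteq> Y \<and> (\<exists>L\<in>X. \<exists>L'\<in>Y. scale_set \<pi> L \<subseteq> L' \<and> L' \<subseteq> L)"

definition affine_building :: "('k::field \<Rightarrow> ereal) \<Rightarrow> 'k \<Rightarrow> ('k ^ 'd) set set set set" where
  "affine_building v \<pi> = flag_complex (lattice_classes v) (adjacent_classes \<pi>)"

text \<open>
  \<open>\<Union>C\<close> is the set of all representatives of the classes in \<open>C\<close>. The family \<open>F\<close> may contain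
  several representatives of one class.
\<close>

definition convex_classes :: "('k::field \<Rightarrow> ereal) \<Rightarrow> ('k ^ 'd) set set set \<Rightarrow> bool" where
  "convex_classes v C \<longleftrightarrow>
     C \<subseteq> lattice_classes v \<and>
     (\<forall>F. finite F \<and> F \<noteq> {} \<and> F \<subseteq> \<Union>C \<longrightarrow> lattice_class v (\<Inter>F) \<in> C)"

definition lattice_conv :: "('k::field \<Rightarrow> ereal) \<Rightarrow> ('k ^ 'd) set set \<Rightarrow> ('k ^ 'd) set set set" where
  "lattice_conv v S = convex_classes v hull (lattice_class v ` S)"

definition conv_complex ::
    "('k::field \<Rightarrow> ereal) \<Rightarrow> 'k \<Rightarrow> ('k ^ 'd) set set \<Rightarrow> ('k ^ 'd) set set set set" where
  "conv_complex v \<pi> S = induced_subcomplex (affine_building v \<pi>) (lattice_conv v S)"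


section \<open>Tropical projective space\<close>

text \<open>
  The tropical numbers \<open>\<real> \<union> {\<infinity>}\<close> are the elements of \<^typ>\<open>ereal\<close> other than \<open>-\<infinity>\<close>, with
  \<^const>\<open>min\<close> as addition and \<open>+\<close> as multiplication. The number \<open>n\<close> is always the number of
  homogeneous coordinates, so that projective space on \<open>n\<close> coordinates has dimension \<open>n - 1\<close>;
  coordinates are indexed by \<open>0, \<dots>, n - 1\<close>.
\<close>

definition trop_vectors :: "nat \<Rightarrow> (nat \<Rightarrow> ereal) set" where
  "trop_vectors n =
     {x \<in> {..<n} \<rightarrow>\<^sub>E (UNIV - {-\<infinity>}). \<exists>i<n. x i \<noteq> \<infinity>}"

definition trop_rel :: "nat \<Rightarrow> ((nat \<Rightarrow> ereal) \<times> (nat \<Rightarrow> ereal)) set" where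
  "trop_rel n =
     {(x, y). x \<in> trop_vectors n \<and> y \<in> trop_vectors n \<and>
              (\<exists>c::real. \<forall>i<n. y i = ereal c + x i)}"

definition trop_proj_space :: "nat \<Rightarrow> (nat \<Rightarrow> ereal) set set" where
  "trop_proj_space n = trop_vectors n // trop_rel n"

definition trop_point :: "nat \<Rightarrow> (nat \<Rightarrow> ereal) \<Rightarrow> (nat \<Rightarrow> ereal) set" where
  "trop_point n x = trop_rel n `` {x}"

definition integer_vectors :: "nat \<Rightarrow> (nat \<Rightarrow> ereal) set" where
  "integer_vectors n = {..<n} \<rightarrow>\<^sub>E range (\<lambda>z::int. ereal (of_int z))"

definition integral_points :: "nat \<Rightarrow> (nat \<Rightarrow> ereal) set set" where
  "integral_points n = {X \<in> trop_proj_space n. \<exists>x\<in>integer_vectors n. X = trop_point n x}"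

text \<open>
  The inserted 0 only matters for \<open>n \<le> 1\<close>, where there is no pair \<open>i < j\<close>. The distance is only
  meaningful for vectors with finite coordinates.
\<close>

definition trop_dist :: "nat \<Rightarrow> (nat \<Rightarrow> ereal) \<Rightarrow> (nat \<Rightarrow> ereal) \<Rightarrow> ereal" where
  "trop_dist n x y = Max (insert 0 {\<bar>x i - x j + y j - y i\<bar> | i j. i < j \<and> j < n})"

text \<open>The distance does not depend on the representatives.\<close>

definition trop_adjacent :: "nat \<Rightarrow> (nat \<Rightarrow> ereal) set \<Rightarrow> (nat \<Rightarrow> ereal) set \<Rightarrow> bool" where
  "trop_adjacent n X Y \<longleftrightarrow> (\<exists>x\<in>X. \<exists>y\<in>Y. trop_dist n x y = 1)"

definition standard_triangulation :: "nat \<Rightarrow> (nat \<Rightarrow> ereal) set set set" where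
  "standard_triangulation n = flag_complex (integral_points n) (trop_adjacent n)"

definition trop_combination ::
    "nat \<Rightarrow> nat \<Rightarrow> (nat \<Rightarrow> ereal) \<Rightarrow> (nat \<Rightarrow> nat \<Rightarrow> ereal) \<Rightarrow> (nat \<Rightarrow> ereal)" where
  "trop_combination n m c p = (\<lambda>i\<in>{..<n}. Min ((\<lambda>k. c k + p k i) ` {..<m}))"

definition trop_polytope :: "nat \<Rightarrow> nat \<Rightarrow> (nat \<Rightarrow> nat \<Rightarrow> ereal) \<Rightarrow> (nat \<Rightarrow> ereal) set set" where
  "trop_polytope n m p =
     {trop_point n (trop_combination n m c p) | c.
        (\<forall>k<m. c k \<noteq> -\<infinity>) \<and> (\<exists>k<m. c k \<noteq> \<infinity>)}"

definition trop_lattice_polytope :: "nat \<Rightarrow> (nat \<Rightarrow> ereal) set set \<Rightarrow> bool" where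
  "trop_lattice_polytope n P \<longleftrightarrow>
     (\<exists>m p. 1 \<le> m \<and> (\<forall>k<m. p k \<in> integer_vectors n) \<and> P = trop_polytope n m p)"

end

theory Submission imports Defs begin

text \<open>
  Write \<open>\<Lambda>\<^sub>i = {x. A\<^sub>i x \<in> R\<^sup>d}\<close>. The convex hull consists of the classes of
  \<open>\<Lambda>(a) = \<Inter>i. \<pi>\<^bsup>a i\<^esup> \<Lambda>\<^sub>i\<close>. For a vector \<open>f \<noteq> 0\<close> and a lattice \<open>L\<close> let
  the level of \<open>f\<close> be the largest \<open>k\<close> with \<open>f \<in> \<pi>\<^bsup>k\<^esup> L\<close>; levels turn intersections into minima
  and scaling by \<open>\<pi>\<close> into translation. Hence, for a finite set \<open>X\<close> of vectors, sending \<open>L\<close> to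
  its levels on \<open>X\<close> maps the convex hull onto the integral points of the tropical polytope
  spanned by the level vectors of the \<open>\<Lambda>\<^sub>i\<close>. This is an isomorphism once every \<open>\<Lambda>(a)\<close> is
  generated by multiples of elements of \<open>X\<close>.

  To find \<open>X\<close>, choose \<open>d\<close> rows of the matrices \<open>A\<^sub>i\<close> minimising the valuation of the determinant
  minus the sum of the corresponding \<open>a i\<close>. By Cramer's rule these rows alone cut out \<open>\<Lambda>(a)\<close>,
  so the dual basis generates it. The minimiser depends on \<open>a\<close> only through the number of rows
  taken from each \<open>A\<^sub>i\<close>, which leaves \<open>(d + s - 1) choose d\<close> bases. As two lattices have a common
  adapted basis, the \<open>d + 1\<close> bases that only involve \<open>A\<^sub>1\<close> and \<open>A\<^sub>2\<close> can be taken equal.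
\<close>

section \<open>A binomial bound\<close>

text \<open>This is the case of three lattices. When \<open>d\<close> grows by one, Pascal's rule
  adds \<open>d + 2\<close> on the left, and the right side gains \<open>2 ^ d + 1\<close>.\<close>

lemma choose_le_power2:
  assumes "2 \<le> d"
  shows "(d + 2) choose d \<le> 2 ^ d + d"
  using assms
proof (induction d rule: dec_induct)
  case base
  show ?case by (simp add: choose_two)
next
  case (step d)
  have "(Suc d + 2) choose Suc d = ((d + 2) choose d) + ((d + 2) choose Suc d)"
    by (simp add: add.commute)
  also have "(d + 2) choose Suc d = d + 2"
    using binomial_symmetric[of "Suc d" "d + 2"] by simp
  finally have eq: "(Suc d + 2) choose Suc d = ((d + 2) choose d) + (d + 2)" .
  show ?case unfolding eq power_Suc using step.IH less_exp[of d] by linarith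
qed

text \<open>Read with subtractions: one more lattice multiplies the surplus of the binomial
  coefficient over \<open>d\<close> by at most \<open>fact d\<close>. The quotient of the two
  coefficients is only \<open>(d + s) / s\<close>.\<close>

lemma choose_step_le_fact:
  assumes d: "2 \<le> d" and s: "3 \<le> s"
  shows "((d + s) choose d) + fact d * d \<le> fact d * ((d + s - 1) choose d) + d"
proof -
  define C C' :: nat where "C = (d + s - 1) choose d" and "C' = (d + s) choose d"
  have CC': "s * C' = (d + s) * C"
  proof -
    have "Suc (d + s - 1) * ((d + s - 1) choose (s - 1)) = (Suc (d + s - 1) choose Suc (s - 1)) * Suc (s - 1)"
      by (rule Suc_times_binomial_eq)
    moreover have "(d + s - 1) choose (s - 1) = C"
      using s binomial_symmetric[of d "d + s - 1"] by (simp add: C_def)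
    moreover have "(d + s) choose s = C'"
      using binomial_symmetric[of d "d + s"] by (simp add: C'_def)
    ultimately show ?thesis using s by (simp add: mult.commute)
  qed
  have C_ge: "(d + 2) * (d + 1) \<le> 2 * C"
  proof -
    have "(d + 2) * (d + 1) = 2 * ((d + 2) choose 2)"
      by (simp add: choose_two algebra_simps)
    also have "(d + 2) choose 2 = (d + 2) choose d"
      using binomial_symmetric[of 2 "d + 2"] by simp
    also have "\<dots> \<le> C" unfolding C_def using s by (intro binomial_right_mono) auto
    finally show ?thesis by simp
  qed
  have "C' + fact d * d \<le> fact d * C + d"
  proof (cases "d = 2")
    \<comment> \<open>The estimate \<open>2 * d \<le> fact d\<close>, on which the general argument
      rests, fails for \<open>d = 2\<close>.\<close>
    case True
    have "(s + 1) * (s + 2) = 2 * C'" "s * (s + 1) = 2 * C"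
      using True s by (simp_all add: C_def C'_def choose_two algebra_simps)
    moreover have "(s + 1) * (s + 2) + 8 \<le> 2 * (s * (s + 1)) + 4"
    proof -
      obtain t where "s = 3 + t" using s le_Suc_ex by blast
      then show ?thesis by (simp add: algebra_simps)
    qed
    ultimately have "C' + 4 \<le> 2 * C + 2" by linarith
    then show ?thesis using True by simp
  next
    case False
    then have d3: "3 \<le> d" using d by simp
    have F: "2 * d \<le> (fact d :: nat)"
    proof -
      have "(fact d :: nat) = d * fact (d - 1)" using d by (simp add: fact_reduce)
      moreover have "(2 :: nat) \<le> fact (d - 1)" using fact_mono_nat[of 2 "d - 1"] d3 by simp
      ultimately show ?thesis by simp
    qed
    have "3 * C' \<le> (3 + d) * C"
    proof -
      have "s * (3 * C') = 3 * (d + s) * C"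
        using arg_cong[OF CC', of "(*) 3"] by (simp only: ac_simps)
      also have "\<dots> \<le> s * (3 + d) * C"
        using s by (intro mult_right_mono) (auto simp: algebra_simps)
      finally show ?thesis using s by (simp add: mult.assoc)
    qed
    then have C': "3 * int C' \<le> (3 + int d) * int C" by (metis of_nat_add of_nat_le_iff of_nat_mult of_nat_numeral)
    \<comment> \<open>With \<open>F = fact d - 1\<close> the claim is
      \<open>C' - C \<le> F * (C - d)\<close>. The left side is at most \<open>d * C / 3\<close>.
      Since \<open>2 * d \<le> C\<close>, the right side is at least \<open>F * C / 2\<close>, and
      \<open>2 * d \<le> 3 * F\<close>.\<close>
    obtain G :: nat where G: "fact d = G + 1" by (metis fact_ge_1 le_add_diff_inverse2)
    define F where "F = int G"
    have F': "2 * int d \<le> F + 1" using F unfolding G F_def by linarith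
    have "2 * d \<le> C"
    proof -
      have "4 * d \<le> (d + 2) * (d + 1)" by (simp add: algebra_simps le_SucI)
      then show ?thesis using C_ge by simp
    qed
    then have Cd: "0 \<le> (int C - 2 * int d) * F" using F' d by (intro mult_nonneg_nonneg) auto
    have "2 * int d * int C \<le> 3 * F * int C"
      using F' d3 by (intro mult_right_mono) auto
    then have "int C' + (F + 1) * int d \<le> (F + 1) * int C + int d"
      using C' Cd by (simp add: algebra_simps)
    then have "int (C' + fact d * d) \<le> int (fact d * C + d)" unfolding G F_def by (simp add: algebra_simps)
    then show ?thesis by (simp only: of_nat_le_iff)
  qed
  then show ?thesis by (simp only: C_def C'_def)
qed

text \<open>After multiplication by \<open>d\<close>, the summand \<open>d\<close> on the right
  accounts for \<open>d * d\<close> vectors. Sharing one basis in \<open>common_spanning_set\<close>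
  saves that many.\<close>

lemma choose_le_power2_fact:
  assumes "2 \<le> d" "3 \<le> s"
  shows "(d + s - 1) choose d \<le> 2 ^ d * fact d ^ (s - 3) + d"
  using assms(2)
proof (induction s rule: dec_induct)
  case base
  show ?case using choose_le_power2[OF assms(1)] by simp
next
  case (step s)
  have "((d + s) choose d) + fact d * d \<le> fact d * ((d + s - 1) choose d) + d"
    using choose_step_le_fact assms(1) step.hyps by blast
  also have "\<dots> \<le> fact d * (2 ^ d * fact d ^ (s - 3) + d) + d"
    using step.IH by simp
  also have "\<dots> = 2 ^ d * fact d ^ (Suc s - 3) + d + fact d * d"
  proof -
    have "Suc s - 3 = Suc (s - 3)" using step.hyps by simp
    then show ?thesis by (simp add: algebra_simps)
  qed
  finally show ?case by simp
qed

section \<open>The normalised valuation\<close>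

locale uniformized_valuation =
  fixes v :: "'k::field \<Rightarrow> ereal" and \<pi> :: 'k
  assumes discrete: "discrete_valuation v" and unif: "uniformizer v \<pi>"
begin

lemma v_mult: "v (x * y) = v x + v y"
  and v_add: "min (v x) (v y) \<le> v (x + y)"
  and v_eq_infinity_iff: "v x = \<infinity> \<longleftrightarrow> x = 0"
  using discrete by (auto simp: discrete_valuation_def)

lemma v_integer: "x \<noteq> 0 \<Longrightarrow> \<exists>n::int. v x = ereal (of_int n)"
  using discrete by (auto simp: discrete_valuation_def)

lemma v_one: "v 1 = 0"
proof -
  obtain n :: int where "v 1 = ereal (of_int n)" using v_integer[of 1] by auto
  then show ?thesis using v_mult[of 1 1] by (simp add: zero_ereal_def)
qed

lemma uniformizer_nonzero: "\<pi> \<noteq> 0"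
  using unif by (simp add: uniformizer_def)

lemma v_uniformizer_pos: "0 < v \<pi>"
proof -
  have "1 \<in> valuation_ring v" by (simp add: valuation_ring_def v_one)
  then have "\<pi> * 1 \<in> {x. 0 < v x}" using unif unfolding uniformizer_def by blast
  then show ?thesis by simp
qed

text \<open>The values of \<open>v\<close> may form a proper subgroup of the integers. Dividing by
  its generator \<open>step\<close> yields an order function that is 1 at
  \<open>\<pi>\<close>.\<close>

definition step :: int where
  "step = \<lfloor>real_of_ereal (v \<pi>)\<rfloor>"

lemma v_uniformizer: "v \<pi> = ereal (of_int step)"
  using v_integer[OF uniformizer_nonzero] by (auto simp: step_def)

lemma step_pos: "0 < step"
  using v_uniformizer_pos v_uniformizer by (simp add: zero_ereal_def)

lemma v_inverse:
  assumes "x \<noteq> 0" and "v x = ereal a"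
  shows "v (inverse x) = ereal (- a)"
proof -
  obtain n :: int where n: "v (inverse x) = ereal (of_int n)"
    using v_integer assms(1) by (metis nonzero_imp_inverse_nonzero)
  have "v x + v (inverse x) = 0" using assms(1) by (simp flip: v_mult add: v_one)
  then show ?thesis using n assms(2) by (simp add: zero_ereal_def)
qed

lemma v_uniformizer_power_int: "v (\<pi> powi k) = ereal (of_int (k * step))"
proof -
  have pow: "v (\<pi> ^ n) = ereal (of_int (int n * step))" for n
    by (induction n) (auto simp: v_one v_mult v_uniformizer zero_ereal_def algebra_simps)
  show ?thesis
  proof (cases "k \<ge> 0")
    case True
    then show ?thesis using pow[of "nat k"] by (simp add: power_int_def)
  next
    case False
    then show ?thesis using v_inverse[OF _ pow[of "nat (- k)"]] uniformizer_nonzero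
      by (simp add: power_int_def flip: power_inverse)
  qed
qed

text \<open>Multiplying \<open>x\<close> by a power of \<open>\<pi>\<close> reduces its value modulo
  \<open>step\<close>. A positive remainder would put the product in the maximal ideal, making it a
  multiple of \<open>\<pi>\<close> and its value at least \<open>step\<close>.\<close>

lemma v_multiple_of_step:
  assumes "x \<noteq> 0"
  shows "\<exists>k. v x = ereal (of_int (k * step))"
proof -
  obtain m :: int where m: "v x = ereal (of_int m)" using v_integer[OF assms] by blast
  define y where "y = x * \<pi> powi (- (m div step))"
  have "v y = ereal (of_int (m - m div step * step))"
    by (simp add: y_def v_mult m v_uniformizer_power_int)
  then have y: "v y = ereal (of_int (m mod step))"
    by (simp add: minus_div_mult_eq_mod)
  have "m mod step = 0"
  proof (rule ccontr)
    assume "m mod step \<noteq> 0"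
    then have "0 < m mod step" using step_pos by (simp add: order_less_le)
    then have "y \<in> {x. 0 < v x}" using y by (simp add: zero_ereal_def)
    then obtain r where r: "y = \<pi> * r" "0 \<le> v r"
      using unif unfolding uniformizer_def valuation_ring_def by blast
    have "v \<pi> \<le> v y" using r by (metis add.right_neutral add_left_mono v_mult)
    then have "step \<le> m mod step" unfolding y v_uniformizer by (simp only: ereal_less_eq of_int_le_iff)
    then show False using pos_mod_bound[OF step_pos, of m] by linarith
  qed
  then show ?thesis using m by (metis mult.commute mult_div_mod_eq add.right_neutral)
qed

definition ord :: "'k \<Rightarrow> int" where
  "ord x = \<lfloor>real_of_ereal (v x)\<rfloor> div step"

lemma v_ord: "x \<noteq> 0 \<Longrightarrow> v x = ereal (of_int (ord x * step))"
  using v_multiple_of_step[of x] step_pos by (auto simp: ord_def simp flip: of_int_mult)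

lemma ord_eqI: "v x = ereal (of_int (k * step)) \<Longrightarrow> ord x = k"
  using step_pos unfolding ord_def by (simp flip: of_int_mult)

lemma ord_mult: "x \<noteq> 0 \<Longrightarrow> y \<noteq> 0 \<Longrightarrow> ord (x * y) = ord x + ord y"
  by (rule ord_eqI) (simp add: v_mult v_ord algebra_simps)

lemma ord_power_int [simp]: "ord (\<pi> powi k) = k"
  by (rule ord_eqI) (rule v_uniformizer_power_int)

lemma ord_one [simp]: "ord 1 = 0"
  using ord_power_int[of 0] by simp

lemma ord_inverse: "x \<noteq> 0 \<Longrightarrow> ord (inverse x) = - ord x"
  using ord_mult[of x "inverse x"] by simp

text \<open>Zero, whose valuation is infinite, has to satisfy every lower bound, whereas
  \<open>ord 0\<close> is an ordinary integer.\<close>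

definition ord_ge :: "int \<Rightarrow> 'k \<Rightarrow> bool" where
  "ord_ge k x \<longleftrightarrow> x = 0 \<or> k \<le> ord x"

lemma ord_ge_iff_v: "ord_ge k x \<longleftrightarrow> ereal (of_int (k * step)) \<le> v x"
  using v_ord[of x] v_eq_infinity_iff[of x] step_pos
  by (cases "x = 0") (auto simp: ord_ge_def simp flip: of_int_mult)

lemma valuation_ring_iff: "x \<in> valuation_ring v \<longleftrightarrow> ord_ge 0 x"
  by (simp add: valuation_ring_def ord_ge_iff_v zero_ereal_def)

lemma ord_ge_0 [simp]: "ord_ge k 0"
  by (simp add: ord_ge_def)

lemma ord_ge_add: "ord_ge k x \<Longrightarrow> ord_ge k y \<Longrightarrow> ord_ge k (x + y)"
  unfolding ord_ge_iff_v using v_add[of x y] by (meson min.boundedI order_trans)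

lemma ord_ge_mult: "ord_ge k x \<Longrightarrow> ord_ge l y \<Longrightarrow> ord_ge (k + l) (x * y)"
  by (cases "x = 0"; cases "y = 0") (auto simp: ord_ge_def ord_mult)

lemma ord_ge_sum: "(\<And>i. i \<in> I \<Longrightarrow> ord_ge k (f i)) \<Longrightarrow> ord_ge k (sum f I)"
  by (induction I rule: infinite_finite_induct) (auto intro: ord_ge_add)

lemma ord_ge_mult_iff: "c \<noteq> 0 \<Longrightarrow> ord_ge k (c * x) \<longleftrightarrow> ord_ge (k - ord c) x"
  by (cases "x = 0") (auto simp: ord_ge_def ord_mult)

lemma ord_ge_minus_one: "ord_ge 0 (- 1)"
proof -
  have "ord (-1) + ord (-1) = 0" using ord_mult[of "-1" "-1"] by simp
  then show ?thesis by (simp add: ord_ge_def)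
qed

lemma ord_ge_diff: "ord_ge k x \<Longrightarrow> ord_ge k y \<Longrightarrow> ord_ge k (x - y)"
  using ord_ge_add[of k x "- 1 * y"] ord_ge_mult[OF ord_ge_minus_one, of k y] by simp

section \<open>Lattices in coordinates\<close>

text \<open>A lattice is described by linear forms, the rows of \<open>A\<close>, instead of
  generators, so that intersecting lattices merely collects conditions. For invertible
  \<open>A\<close>, the columns of the inverse scaled by \<open>\<pi> powi (a j)\<close> are a basis
  over the valuation ring.\<close>

definition box :: "'k ^ 'd ^ 'd \<Rightarrow> ('d \<Rightarrow> int) \<Rightarrow> ('k ^ 'd) set" where
  "box A a = {x. \<forall>j. ord_ge (a j) ((A *v x) $ j)}"

lemma mem_box: "x \<in> box A a \<longleftrightarrow> (\<forall>j. ord_ge (a j) ((A *v x) $ j))"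
  by (simp add: box_def)

lemma column_expansion:
  fixes A C :: "'k ^ 'd ^ 'd"
  assumes "C ** A = mat 1"
  shows "x = (\<Sum>j\<in>UNIV. (A *v x) $ j *s column j C)"
proof -
  have "x = C *v (A *v x)" using assms by (simp add: matrix_vector_mul_assoc)
  then show ?thesis by (simp only: matrix_mult_sum)
qed

lemma row_mult_column_inverse:
  fixes A C :: "'k ^ 'd ^ 'd"
  assumes "A ** C = mat 1"
  shows "(A *v column j C) $ i = (if i = j then 1 else 0)"
proof -
  have "(A *v column j C) $ i = (A ** C) $ i $ j"
    by (simp add: matrix_vector_mult_def matrix_matrix_mult_def column_def)
  then show ?thesis using assms by (simp add: mat_def)
qed

lemma inj_column:
  fixes C :: "'k ^ 'd ^ 'd"
  assumes "A ** C = mat 1"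
  shows "inj (\<lambda>j. column j C)"
proof (rule injI)
  fix i j assume "column i C = column j C"
  then show "i = j"
    using row_mult_column_inverse[OF assms, of i i] row_mult_column_inverse[OF assms, of j i]
    by (auto split: if_splits)
qed

lemma independent_columns:
  fixes C :: "'k ^ 'd ^ 'd"
  assumes "A ** C = mat 1"
  shows "vec.independent (range (\<lambda>j. column j C))"
  unfolding vec.independent_explicit_finite_subsets
proof (intro allI impI ballI)
  fix S u b assume S: "S \<subseteq> range (\<lambda>j. column j C)" "finite S" "(\<Sum>b\<in>S. u b *s b) = 0" "b \<in> S"
  obtain i where i: "b = column i C" using S by auto
  have "(A *v c) $ i = (if c = b then 1 else 0)" if c: "c \<in> S" for c
  proof -
    obtain j where j: "c = column j C" using S c by blast
    have "column j C = column i C \<longleftrightarrow> j = i" using inj_eq[OF inj_column[OF assms]] .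
    then show ?thesis unfolding j i by (simp add: row_mult_column_inverse[OF assms])
  qed
  then have "(A *v (\<Sum>b\<in>S. u b *s b)) $ i = (\<Sum>c\<in>S. u c * (if c = b then 1 else 0))"
    by (simp add: vec.linear_sum[OF matrix_vector_mul_linear_gen] vec.linear_scale[OF matrix_vector_mul_linear_gen])
  also have "\<dots> = u b" using S by (simp add: if_distrib sum.delta' cong: if_cong)
  finally show "u b = 0" using S(3) by simp
qed

lemma box_eq_image:
  fixes A C :: "'k ^ 'd ^ 'd"
  assumes "A ** C = mat 1"
  shows "box A a = {(\<Sum>j\<in>UNIV. (c j * \<pi> powi (a j)) *s column j C) | c. \<forall>j. ord_ge 0 (c j)}"
    (is "_ = ?S")
proof (intro equalityI subsetI)
  fix x assume x: "x \<in> box A a"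
  let ?c = "\<lambda>j. \<pi> powi (- a j) * (A *v x) $ j"
  have "ord_ge 0 (?c j)" for j
    using x uniformizer_nonzero by (simp add: mem_box ord_ge_mult_iff)
  moreover have "?c j * \<pi> powi (a j) = (A *v x) $ j" for j
    using uniformizer_nonzero by (simp add: power_int_minus)
  moreover have "x = (\<Sum>j\<in>UNIV. (A *v x) $ j *s column j C)"
    using assms matrix_left_right_inverse column_expansion by blast
  ultimately show "x \<in> ?S"
    by (intro CollectI exI[of _ ?c] conjI) (simp_all only: simp_thms)
next
  fix x assume "x \<in> ?S"
  then obtain c where c: "x = (\<Sum>j\<in>UNIV. (c j * \<pi> powi (a j)) *s column j C)" "\<forall>j. ord_ge 0 (c j)"
    by blast
  have "x = C *v (\<chi> j. c j * \<pi> powi (a j))" by (simp only: c(1) matrix_mult_sum vec_lambda_beta)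
  then have "A *v x = (\<chi> j. c j * \<pi> powi (a j))"
    using assms by (simp add: matrix_vector_mul_assoc)
  then show "x \<in> box A a"
    using c(2) uniformizer_nonzero by (simp add: mem_box mult.commute[of "c _"] ord_ge_mult_iff)
qed

definition scale_rows :: "('d \<Rightarrow> int) \<Rightarrow> 'k ^ 'd ^ 'd \<Rightarrow> 'k ^ 'd ^ 'd" where
  "scale_rows a A = (\<chi> i j. \<pi> powi (a i) * A $ i $ j)"

lemma scale_rows_mult_vec: "(scale_rows a A *v x) $ i = \<pi> powi (a i) * (A *v x) $ i"
  by (simp add: scale_rows_def matrix_vector_mult_def sum_distrib_left mult.assoc)

lemma invertible_scale_rows:
  fixes A :: "'k ^ 'd ^ 'd"
  assumes "invertible A"
  shows "invertible (scale_rows a A)"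
  unfolding invertible_left_inverse matrix_left_invertible_injective inj_def
proof (intro allI impI)
  fix x y assume "scale_rows a A *v x = scale_rows a A *v y"
  then have "A *v x = A *v y"
    using uniformizer_nonzero by (auto simp: vec_eq_iff scale_rows_mult_vec)
  then show "x = y"
    using assms unfolding invertible_left_inverse matrix_left_invertible_injective
    by (auto dest: injD)
qed

lemma box_scale_rows: "box (scale_rows b A) a = box A (\<lambda>j. a j - b j)"
  using uniformizer_nonzero by (auto simp: mem_box scale_rows_mult_vec ord_ge_mult_iff)

lemma is_lattice_box:
  fixes A :: "'k ^ 'd ^ 'd"
  assumes "invertible A"
  shows "is_lattice v (box A a)"
proof -
  \<comment> \<open>Scaling the rows absorbs the levels \<open>a\<close>, so that the columns of the
    inverse of \<open>A'\<close> form a basis as they stand.\<close>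
  define A' where "A' = scale_rows (\<lambda>j. - a j) A"
  have box: "box A a = box A' (\<lambda>_. 0)" by (simp add: A'_def box_scale_rows)
  obtain C where C: "A' ** C = mat 1"
    using invertible_scale_rows[OF assms] unfolding A'_def invertible_def by blast
  let ?f = "\<lambda>j. column j C"
  have inv: "inv ?f (?f j) = j" for j using inv_f_f[OF inj_column[OF C]] .
  have sum_range: "(\<Sum>b\<in>range ?f. g b) = (\<Sum>j\<in>UNIV. g (?f j))" for g :: "_ \<Rightarrow> 'k ^ 'd"
    using inj_column[OF C] by (simp add: sum.reindex)
  have "box A a = {(\<Sum>b\<in>range ?f. c b *s b) | c. \<forall>b\<in>range ?f. c b \<in> valuation_ring v}"
    unfolding box box_eq_image[OF C]
  proof (intro equalityI subsetI; elim CollectE exE conjE)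
    fix x c assume *: "x = (\<Sum>j\<in>UNIV. (c j * \<pi> powi 0) *s ?f j)" "\<forall>j. ord_ge 0 (c j)"
    let ?c = "\<lambda>b. c (inv ?f b)"
    have "x = (\<Sum>b\<in>range ?f. ?c b *s b)"
      unfolding sum_range inv using *(1) by simp
    then show "x \<in> {(\<Sum>b\<in>range ?f. c b *s b) | c. \<forall>b\<in>range ?f. c b \<in> valuation_ring v}"
      using *(2) by (intro CollectI exI[of _ ?c] conjI) (simp_all add: valuation_ring_iff inv)
  next
    fix x c assume *: "x = (\<Sum>b\<in>range ?f. c b *s b)" "\<forall>b\<in>range ?f. c b \<in> valuation_ring v"
    then show "x \<in> {(\<Sum>j\<in>UNIV. (c j * \<pi> powi 0) *s ?f j) | c. \<forall>j. ord_ge 0 (c j)}"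
      by (intro CollectI exI[of _ "\<lambda>j. c (?f j)"] conjI) (simp_all add: valuation_ring_iff sum_range)
  qed
  moreover have "card (range ?f) = CARD('d)" using inj_column[OF C] by (simp add: card_image)
  ultimately show ?thesis
    unfolding is_lattice_def using independent_columns[OF C] by (intro exI[of _ "range ?f"]) simp
qed

text \<open>The basis vectors become the columns of \<open>C\<close>. The rows of its inverse are
  the coordinate forms, which are integral exactly on the lattice.\<close>

lemma is_lattice_imp_box:
  fixes L :: "('k ^ 'd) set"
  assumes "is_lattice v L"
  obtains A :: "'k ^ 'd ^ 'd" where "invertible A" "L = box A (\<lambda>_. 0)"
proof -
  obtain B where B: "finite B" "card B = CARD('d)" "vec.independent B"
    and L: "L = {(\<Sum>b\<in>B. c b *s b) | c. \<forall>b\<in>B. c b \<in> valuation_ring v}"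
    using assms unfolding is_lattice_def by blast
  obtain f :: "'d \<Rightarrow> _" where f: "bij_betw f UNIV B"
    using finite_same_card_bij[OF finite_class.finite_UNIV B(1)] B(2) by metis
  have inv: "inv f (f j) = j" for j using f by (simp add: bij_betw_def)
  define C :: "'k ^ 'd ^ 'd" where "C = (\<chi> i j. f j $ i)"
  have col: "column j C = f j" for j by (simp add: C_def column_def vec_eq_iff)
  have indep: "\<forall>c. (\<Sum>i\<in>UNIV. c i *s f i) = 0 \<longrightarrow> (\<forall>i. c i = 0)"
  proof (intro allI impI)
    fix c i assume 0: "(\<Sum>i\<in>UNIV. c i *s f i) = 0"
    have "(\<Sum>b\<in>B. c (inv f b) *s b) = (\<Sum>i\<in>UNIV. c i *s f i)"
      unfolding sum.reindex_bij_betw[OF f, symmetric] inv ..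
    then have "(\<Sum>b\<in>B. c (inv f b) *s b) = 0" using 0 by simp
    moreover have "f i \<in> B" using f by (auto simp: bij_betw_def)
    ultimately have "c (inv f (f i)) = 0"
      using B(1,3) vec.independentD[OF B(3,1) subset_refl] by metis
    then show "c i = 0" by (simp add: inv)
  qed
  have "\<exists>A. A ** C = mat 1"
    unfolding matrix_left_invertible_independent_columns col by (rule indep)
  then obtain A where A: "A ** C = mat 1" ..
  then have inv_A: "invertible A" and AC: "A ** C = mat 1"
    using matrix_left_right_inverse unfolding invertible_def by blast+
  have "L = box A (\<lambda>_. 0)"
    unfolding box_eq_image[OF AC] L col
  proof (intro equalityI subsetI; elim CollectE exE conjE)
    fix x c assume *: "x = (\<Sum>b\<in>B. c b *s b)" "\<forall>b\<in>B. c b \<in> valuation_ring v"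
    have "x = (\<Sum>j\<in>UNIV. c (f j) *s f j)"
      unfolding * by (rule sum.reindex_bij_betw[OF f, symmetric])
    then show "x \<in> {(\<Sum>j\<in>UNIV. (c j * \<pi> powi 0) *s f j) | c. \<forall>j. ord_ge 0 (c j)}"
      using *(2) bij_betwE[OF f]
      by (intro CollectI exI[of _ "\<lambda>j. c (f j)"] conjI) (simp_all add: valuation_ring_iff)
  next
    fix x c assume *: "x = (\<Sum>j\<in>UNIV. (c j * \<pi> powi 0) *s f j)" "\<forall>j. ord_ge 0 (c j)"
    have "x = (\<Sum>b\<in>B. c (inv f b) *s b)"
      unfolding sum.reindex_bij_betw[OF f, symmetric] inv using *(1) by simp
    then show "x \<in> {(\<Sum>b\<in>B. c b *s b) | c. \<forall>b\<in>B. c b \<in> valuation_ring v}"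
      using *(2) by (intro CollectI exI[of _ "\<lambda>b. c (inv f b)"] conjI) (simp_all add: valuation_ring_iff)
  qed
  with inv_A show ?thesis by (rule that)
qed

section \<open>A common spanning set for all intersections\<close>

definition inter :: "nat set \<Rightarrow> (nat \<Rightarrow> 'k ^ 'd ^ 'd) \<Rightarrow> (nat \<Rightarrow> int) \<Rightarrow> ('k ^ 'd) set" where
  "inter I A a = (\<Inter>i\<in>I. box (A i) (\<lambda>_. a i))"

definition select :: "(nat \<Rightarrow> 'k ^ 'd ^ 'd) \<Rightarrow> ('d \<Rightarrow> nat \<times> 'd) \<Rightarrow> 'k ^ 'd ^ 'd" where
  "select A \<sigma> = (\<chi> l. A (fst (\<sigma> l)) $ snd (\<sigma> l))"

lemma select_mult_vec: "(select A \<sigma> *v x) $ l = (A (fst (\<sigma> l)) *v x) $ snd (\<sigma> l)"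
  by (simp add: select_def matrix_vector_mult_def)

definition selections :: "nat set \<Rightarrow> (nat \<Rightarrow> 'k ^ 'd ^ 'd) \<Rightarrow> ('d \<Rightarrow> nat \<times> 'd) set" where
  "selections I A = {\<sigma>. (\<forall>l. fst (\<sigma> l) \<in> I) \<and> det (select A \<sigma>) \<noteq> 0}"

text \<open>This is the order of the determinant after each selected row has been divided by the
  power of \<open>\<pi>\<close> that its form is required to reach.\<close>

definition excess ::
    "(nat \<Rightarrow> 'k ^ 'd ^ 'd) \<Rightarrow> (nat \<Rightarrow> int) \<Rightarrow> ('d \<Rightarrow> nat \<times> 'd) \<Rightarrow> int" where
  "excess A a \<sigma> = ord (det (select A \<sigma>)) - (\<Sum>l\<in>UNIV. a (fst (\<sigma> l)))"

text \<open>
  By Cramer's rule the coefficients expressing any other row in terms of the selected ones are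
  quotients of determinants, which minimality of the excess bounds from below.
\<close>

lemma inter_eq_box_select:
  fixes A :: "nat \<Rightarrow> 'k ^ 'd ^ 'd"
  assumes \<sigma>: "\<sigma> \<in> selections I A"
    and min: "\<And>\<tau>. \<tau> \<in> selections I A \<Longrightarrow> excess A a \<sigma> \<le> excess A a \<tau>"
  shows "inter I A a = box (select A \<sigma>) (\<lambda>l. a (fst (\<sigma> l)))"
proof (intro equalityI subsetI)
  fix x assume "x \<in> inter I A a"
  then show "x \<in> box (select A \<sigma>) (\<lambda>l. a (fst (\<sigma> l)))"
    using \<sigma> by (auto simp: inter_def mem_box select_mult_vec selections_def)
next
  fix x assume x: "x \<in> box (select A \<sigma>) (\<lambda>l. a (fst (\<sigma> l)))"
  let ?B = "select A \<sigma>"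
  obtain C where C: "C ** ?B = mat 1"
    using \<sigma> by (auto simp: selections_def invertible_det_nz[symmetric] invertible_left_inverse)
  have "ord_ge (a i) ((A i *v x) $ j)" if "i \<in> I" for i j
  proof -
    define c where "c = transpose C *v (A i $ j)"
    have row: "A i $ j = (\<Sum>l\<in>UNIV. c $ l *s row l ?B)"
    proof -
      have "A i $ j = transpose ?B *v c"
        by (simp only: c_def matrix_vector_mul_assoc matrix_transpose_mul[symmetric] C transpose_mat
            matrix_vector_mul_lid)
      then show ?thesis by (simp only: matrix_mult_sum column_transpose)
    qed
    have "ord_ge (a i - a (fst (\<sigma> l))) (c $ l)" for l
    proof (cases "c $ l = 0")
      case False
      \<comment> \<open>Exchanging selected row \<open>l\<close> for row \<open>j\<close> of
        \<open>A i\<close> multiplies the determinant by \<open>c $ l\<close>. As this coefficient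
        is nonzero, the result is again a selection, and its excess can be compared with that of
        \<open>\<sigma>\<close>.\<close>
      define \<tau> where "\<tau> = \<sigma>(l := (i, j))"
      have "select A \<tau> = (\<chi> m. if m = l then (\<Sum>l\<in>UNIV. c $ l *s row l ?B) else row m ?B)"
        unfolding row[symmetric] by (simp add: select_def \<tau>_def vec_eq_iff row_def)
      then have det: "det (select A \<tau>) = c $ l * det ?B"
        using cramer_lemma_transpose[of l c ?B] by simp
      have "det ?B \<noteq> 0" using \<sigma> by (simp add: selections_def)
      then have "\<tau> \<in> selections I A" and ord: "ord (det (select A \<tau>)) = ord (c $ l) + ord (det ?B)"
        using det False \<sigma> \<open>i \<in> I\<close> by (auto simp: selections_def \<tau>_def ord_mult)
      moreover have "(\<Sum>m\<in>UNIV. a (fst (\<tau> m))) = (\<Sum>m\<in>UNIV. a (fst (\<sigma> m))) - a (fst (\<sigma> l)) + a i"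
        by (simp add: \<tau>_def sum.remove[of UNIV l])
      ultimately have "a i - a (fst (\<sigma> l)) \<le> ord (c $ l)"
        using min[of \<tau>] by (simp add: excess_def)
      then show ?thesis by (simp add: ord_ge_def)
    qed simp
    then have "ord_ge (a i) (c $ l * (?B *v x) $ l)" for l
      using x ord_ge_mult[of "a i - a (fst (\<sigma> l))" "c $ l" "a (fst (\<sigma> l))" "(?B *v x) $ l"]
      by (simp add: mem_box)
    then have "ord_ge (a i) (\<Sum>l\<in>UNIV. c $ l * (?B *v x) $ l)"
      by (intro ord_ge_sum)
    also have "(\<Sum>l\<in>UNIV. c $ l * (?B *v x) $ l) = (\<Sum>l\<in>UNIV. \<Sum>m\<in>UNIV. c $ l * (?B $ l $ m * x $ m))"
      by (simp add: matrix_vector_mult_def sum_distrib_left)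
    also have "\<dots> = (\<Sum>m\<in>UNIV. \<Sum>l\<in>UNIV. c $ l * (?B $ l $ m * x $ m))"
      by (rule sum.swap)
    also have "\<dots> = (A i *v x) $ j"
      by (simp add: matrix_vector_mult_def row row_def sum_distrib_right mult.assoc)
    finally show ?thesis .
  qed
  then show "x \<in> inter I A a" by (simp add: inter_def mem_box)
qed

definition profile :: "('d::finite \<Rightarrow> nat \<times> 'd) \<Rightarrow> nat multiset" where
  "profile \<sigma> = image_mset (\<lambda>l. fst (\<sigma> l)) (mset_set UNIV)"

lemma sum_profile: "(\<Sum>l\<in>UNIV. a (fst (\<sigma> l))) = \<Sum>\<^sub># (image_mset a (profile \<sigma>))"
  by (simp add: profile_def sum_unfold_sum_mset multiset.map_comp comp_def)

lemma profile_in_multisets_of_size: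
  fixes \<sigma> :: "'d::finite \<Rightarrow> nat \<times> 'd"
  assumes "\<And>l. fst (\<sigma> l) \<in> I"
  shows "profile \<sigma> \<in> multisets_of_size I CARD('d)"
  using assms by (auto simp: profile_def multisets_of_size_def)

lemma in_profile: "fst (\<sigma> l) \<in># profile \<sigma>"
  by (simp add: profile_def)

lemma finite_selections:
  fixes A :: "nat \<Rightarrow> 'k ^ 'd ^ 'd"
  assumes "finite I"
  shows "finite (selections I A)"
proof (rule finite_subset)
  show "selections I A \<subseteq> (\<Pi>\<^sub>E l\<in>UNIV. I \<times> UNIV)"
    by (auto simp: selections_def PiE_def Pi_def mem_Times_iff)
  show "finite ((\<Pi>\<^sub>E l\<in>UNIV. I \<times> UNIV) :: ('d \<Rightarrow> nat \<times> 'd) set)"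
    using assms by (intro finite_PiE) auto
qed

lemma selections_nonempty:
  fixes A :: "nat \<Rightarrow> 'k ^ 'd ^ 'd"
  assumes "i \<in> I" "invertible (A i)"
  shows "selections I A \<noteq> {}"
proof -
  have "select A (\<lambda>l. (i, l)) = A i" by (simp add: select_def vec_eq_iff)
  then have "(\<lambda>l. (i, l)) \<in> selections I A"
    using assms by (simp add: selections_def invertible_det_nz)
  then show ?thesis by blast
qed

lemma excess_minimizer_exists:
  fixes A :: "nat \<Rightarrow> 'k ^ 'd ^ 'd"
  assumes "finite I" "i \<in> I" "invertible (A i)"
  obtains \<sigma> where "\<sigma> \<in> selections I A" "\<And>\<tau>. \<tau> \<in> selections I A \<Longrightarrow> excess A a \<sigma> \<le> excess A a \<tau>"
  using ex_is_arg_min_if_finite[OF finite_selections selections_nonempty, of I i A "excess A a"] assms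
  by (auto simp: is_arg_min_linorder)

text \<open>The shifts enter the excess only through the profile, so one selection serves all shifts.\<close>

lemma profile_representatives:
  fixes A :: "nat \<Rightarrow> 'k ^ 'd ^ 'd"
  assumes "finite I" "i \<in> I" "invertible (A i)"
  obtains \<tau> :: "nat multiset \<Rightarrow> 'd \<Rightarrow> nat \<times> 'd" where
    "\<And>a. \<exists>m\<in>multisets_of_size I CARD('d). \<tau> m \<in> selections I A \<and> profile (\<tau> m) = m \<and>
       inter I A a = box (select A (\<tau> m)) (\<lambda>l. a (fst (\<tau> m l)))"
proof -
  define S where "S m = {\<sigma> \<in> selections I A. profile \<sigma> = m}" for m
  let ?f = "\<lambda>\<sigma> :: 'd \<Rightarrow> nat \<times> 'd. ord (det (select A \<sigma>))"
  have "finite (S m)" for m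
    unfolding S_def by (rule finite_subset[OF _ finite_selections[OF assms(1), of A]]) blast
  then have ex: "\<exists>\<sigma>. is_arg_min ?f (\<lambda>\<sigma>. \<sigma> \<in> S m) \<sigma>" if "S m \<noteq> {}" for m
    using ex_is_arg_min_if_finite that by blast
  define \<tau> where "\<tau> m = (SOME \<sigma>. is_arg_min ?f (\<lambda>\<sigma>. \<sigma> \<in> S m) \<sigma>)" for m
  have \<tau>: "\<tau> m \<in> S m" "\<And>\<sigma>. \<sigma> \<in> S m \<Longrightarrow> ?f (\<tau> m) \<le> ?f \<sigma>" if "S m \<noteq> {}" for m
  proof -
    have "is_arg_min ?f (\<lambda>\<sigma>. \<sigma> \<in> S m) (\<tau> m)"
      unfolding \<tau>_def by (rule someI_ex[OF ex[OF that]])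
    then show "\<tau> m \<in> S m" "\<And>\<sigma>. \<sigma> \<in> S m \<Longrightarrow> ?f (\<tau> m) \<le> ?f \<sigma>"
      by (auto simp: is_arg_min_linorder)
  qed
  show ?thesis
  proof (rule that)
    fix a
    obtain \<sigma> where \<sigma>: "\<sigma> \<in> selections I A"
      and min: "\<And>\<tau>. \<tau> \<in> selections I A \<Longrightarrow> excess A a \<sigma> \<le> excess A a \<tau>"
      using excess_minimizer_exists[where A = A and i = i and a = a, OF assms] by blast
    let ?m = "profile \<sigma>"
    have \<sigma>S: "\<sigma> \<in> S ?m" using \<sigma> by (simp add: S_def)
    then have S: "S ?m \<noteq> {}" by blast
    have sel: "\<tau> ?m \<in> selections I A" and prof: "profile (\<tau> ?m) = ?m"
      using \<tau>(1)[OF S] by (auto simp: S_def)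
    \<comment> \<open>Equal profiles give equal sums of shifts, so within one profile the least
      determinant order means the least excess. Hence \<open>\<tau> ?m\<close> is as good as the
      global minimiser \<open>\<sigma>\<close>.\<close>
    have "excess A a (\<tau> ?m) \<le> excess A a \<sigma>"
      using \<tau>(2)[OF S \<sigma>S] by (simp add: excess_def sum_profile prof)
    then have "inter I A a = box (select A (\<tau> ?m)) (\<lambda>l. a (fst (\<tau> ?m l)))"
      using min by (intro inter_eq_box_select[OF sel]) force
    moreover have "?m \<in> multisets_of_size I CARD('d)"
      using \<sigma> by (intro profile_in_multisets_of_size) (auto simp: selections_def)
    ultimately show "\<exists>m\<in>multisets_of_size I CARD('d). \<tau> m \<in> selections I A \<and> profile (\<tau> m) = m \<and>
       inter I A a = box (select A (\<tau> m)) (\<lambda>l. a (fst (\<tau> m l)))"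
      using sel prof by blast
  qed
qed

text \<open>Each summand, and not only the sum, must lie in \<open>L\<close>. Thus a lattice
  \<open>L\<close> is determined by the multiples of elements of \<open>X\<close> that it contains,
  and these are what levels record.\<close>

definition spanning :: "('k ^ 'd) set \<Rightarrow> ('k ^ 'd) set \<Rightarrow> bool" where
  "spanning X L \<longleftrightarrow> (\<forall>x\<in>L. \<exists>y. x = (\<Sum>f\<in>X. y f *s f) \<and> (\<forall>f\<in>X. y f *s f \<in> L))"

lemma zero_in_box: "0 \<in> box A a"
  by (simp add: mem_box)

lemma zero_in_inter: "0 \<in> inter I A a"
  by (simp add: inter_def zero_in_box)

lemma spanning_mono:
  assumes "spanning X L" "X \<subseteq> Y" "finite Y" "0 \<in> L"
  shows "spanning Y L"
  unfolding spanning_def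
proof
  fix x assume "x \<in> L"
  then obtain y where y: "x = (\<Sum>f\<in>X. y f *s f)" "\<forall>f\<in>X. y f *s f \<in> L"
    using assms(1) unfolding spanning_def by blast
  let ?y = "\<lambda>f. if f \<in> X then y f else 0"
  have "x = (\<Sum>f\<in>Y. ?y f *s f)"
    unfolding y(1) using assms by (intro sum.mono_neutral_cong_left) auto
  then show "\<exists>y. x = (\<Sum>f\<in>Y. y f *s f) \<and> (\<forall>f\<in>Y. y f *s f \<in> L)"
    using y(2) assms(4) by (intro exI[of _ ?y]) auto
qed

text \<open>The components of \<open>x\<close> along the basis dual to the rows of \<open>A\<close>
  serve as summands, so stability of \<open>L\<close> under the coordinate projections
  suffices.\<close>

lemma spanning_columns:
  fixes A C :: "'k ^ 'd ^ 'd"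
  assumes "A ** C = mat 1" and "\<And>x j. x \<in> L \<Longrightarrow> (A *v x) $ j *s column j C \<in> L"
  shows "spanning (range (\<lambda>j. column j C)) L"
  unfolding spanning_def
proof
  fix x assume "x \<in> L"
  let ?f = "\<lambda>j. column j C"
  have inv: "inv ?f (?f j) = j" for j using inv_f_f[OF inj_column[OF assms(1)]] .
  have "x = (\<Sum>j\<in>UNIV. (A *v x) $ j *s ?f j)"
    using assms(1) matrix_left_right_inverse column_expansion by blast
  also have "\<dots> = (\<Sum>b\<in>range ?f. (A *v x) $ inv ?f b *s b)"
    using inj_column[OF assms(1)] by (simp add: sum.reindex inv)
  finally show "\<exists>y. x = (\<Sum>f\<in>range ?f. y f *s f) \<and> (\<forall>f\<in>range ?f. y f *s f \<in> L)"
    using assms(2)[OF \<open>x \<in> L\<close>]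
    by (intro exI[of _ "\<lambda>b. (A *v x) $ inv ?f b"] conjI) (simp_all add: inv)
qed

lemma mult_scaled_column:
  fixes A C :: "'k ^ 'd ^ 'd"
  assumes "A ** C = mat 1"
  shows "(A *v (c *s column j C)) $ i = (if i = j then c else 0)"
  by (simp add: vec.linear_scale[OF matrix_vector_mul_linear_gen] row_mult_column_inverse[OF assms])

lemma spanning_box:
  assumes "A ** C = mat 1"
  shows "spanning (range (\<lambda>j. column j C)) (box A a)"
  by (rule spanning_columns[OF assms]) (simp add: mem_box mult_scaled_column[OF assms])

section \<open>Bases adapted to two lattices\<close>

lemma matrix_entries_lower_bound:
  fixes M :: "'k ^ 'n ^ 'm"
  obtains k where "\<And>i j. ord_ge k (M $ i $ j)"
proof
  fix i j
  let ?S = "(\<lambda>(i, j). ord (M $ i $ j)) ` UNIV"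
  have "Min ?S \<le> ord (M $ i $ j)" by (rule Min_le) auto
  then show "ord_ge (Min ?S) (M $ i $ j)" by (simp add: ord_ge_def)
qed

lemma ord_ge_matrix_mult_vec:
  assumes "\<And>j. ord_ge k (M $ i $ j)" "\<And>j. ord_ge l (x $ j)"
  shows "ord_ge (k + l) ((M *v x) $ i)"
  unfolding matrix_vector_mult_def using assms by (auto intro!: ord_ge_sum ord_ge_mult)

definition replace_row :: "'d \<Rightarrow> 'k ^ 'd \<Rightarrow> 'k ^ 'd ^ 'd \<Rightarrow> 'k ^ 'd ^ 'd" where
  "replace_row j c A = (\<chi> i. if i = j then (\<Sum>l\<in>UNIV. c $ l *s row l A) else row i A)"

lemma replace_row_mult_vec:
  fixes A :: "'k ^ 'd ^ 'd"
  shows "(replace_row j c A *v x) $ i =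
    (if i = j then (\<Sum>l\<in>UNIV. c $ l * (A *v x) $ l) else (A *v x) $ i)"
proof (cases "i = j")
  case True
  have "(replace_row j c A *v x) $ j = (\<Sum>m\<in>UNIV. \<Sum>l\<in>UNIV. c $ l * (A $ l $ m * x $ m))"
    by (simp add: replace_row_def matrix_vector_mult_def row_def sum_distrib_right mult.assoc)
  also have "\<dots> = (\<Sum>l\<in>UNIV. \<Sum>m\<in>UNIV. c $ l * (A $ l $ m * x $ m))"
    by (rule sum.swap)
  also have "\<dots> = (\<Sum>l\<in>UNIV. c $ l * (A *v x) $ l)"
    by (simp add: matrix_vector_mult_def sum_distrib_left)
  finally show ?thesis using True by simp
qed (simp add: replace_row_def matrix_vector_mult_def row_def)

lemma invertible_replace_row:
  assumes "invertible A" "c $ j \<noteq> 0"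
  shows "invertible (replace_row j c A)"
  using assms by (simp add: invertible_det_nz replace_row_def cramer_lemma_transpose)

text \<open>As \<open>c $ j\<close> is a unit, the old row \<open>j\<close> is recovered from the
  new row and the other rows with coefficients in the valuation ring.\<close>

lemma box_replace_row:
  fixes A :: "'k ^ 'd ^ 'd"
  assumes c: "\<And>l. ord_ge 0 (c $ l)" "c $ j \<noteq> 0" "ord (c $ j) = 0"
  shows "box (replace_row j c A) (\<lambda>_. 0) = box A (\<lambda>_. 0)"
proof (intro equalityI subsetI)
  fix x assume x: "x \<in> box A (\<lambda>_. 0)"
  then have "ord_ge 0 (c $ l * (A *v x) $ l)" for l
    using ord_ge_mult[OF c(1), of 0] by (simp add: mem_box)
  then show "x \<in> box (replace_row j c A) (\<lambda>_. 0)"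
    using x by (auto simp: mem_box replace_row_mult_vec intro: ord_ge_sum)
next
  fix x assume x: "x \<in> box (replace_row j c A) (\<lambda>_. 0)"
  have other: "ord_ge 0 ((A *v x) $ i)" if "i \<noteq> j" for i
    using x that by (auto simp: mem_box replace_row_mult_vec dest: spec[of _ i])
  have "ord_ge 0 ((\<Sum>l\<in>UNIV. c $ l * (A *v x) $ l) - (\<Sum>l\<in>UNIV - {j}. c $ l * (A *v x) $ l))"
  proof (rule ord_ge_diff)
    show "ord_ge 0 (\<Sum>l\<in>UNIV. c $ l * (A *v x) $ l)"
      using x by (auto simp: mem_box replace_row_mult_vec dest: spec[of _ j])
    show "ord_ge 0 (\<Sum>l\<in>UNIV - {j}. c $ l * (A *v x) $ l)"
      using ord_ge_mult[OF c(1) other] by (intro ord_ge_sum) auto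
  qed
  also have "(\<Sum>l\<in>UNIV. c $ l * (A *v x) $ l) - (\<Sum>l\<in>UNIV - {j}. c $ l * (A *v x) $ l) = c $ j * (A *v x) $ j"
    by (simp add: sum.remove[of UNIV j])
  finally have "ord_ge 0 ((A *v x) $ j)" using c(2,3) by (simp add: ord_ge_mult_iff)
  then show "x \<in> box A (\<lambda>_. 0)" using other unfolding mem_box by metis
qed

text \<open>
  Among the bases of \<open>box A\<^sub>1\<close> (given by dual rows) with row levels \<open>e\<close> relative to
  \<open>box A\<^sub>2\<close>, one of maximal total level is adapted to \<open>box A\<^sub>2\<close>: otherwise a combination
  of the rows with a unit coefficient would have a higher level and could replace a row.
\<close>

lemma common_apartment:
  fixes A\<^sub>1 A\<^sub>2 :: "'k ^ 'd ^ 'd"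
  assumes "invertible A\<^sub>1" "invertible A\<^sub>2"
  obtains A e where "invertible A" "box A (\<lambda>_. 0) = box A\<^sub>1 (\<lambda>_. 0)"
    "box A e = box A\<^sub>2 (\<lambda>_. 0)"
proof -
  obtain C\<^sub>1 where C1: "C\<^sub>1 ** A\<^sub>1 = mat 1"
    using assms(1) unfolding invertible_left_inverse by blast
  obtain C where C: "A\<^sub>2 ** C = mat 1" "C ** A\<^sub>2 = mat 1"
    using assms(2) unfolding invertible_def by blast
  \<comment> \<open>The columns of \<open>C\<close> generate
    \<open>box A\<^sub>2 (\<lambda>_. 0)\<close>. The last condition therefore says that row
    \<open>j\<close> of \<open>A\<close> takes values of order at least \<open>e j\<close> on this
    lattice, that is \<open>box A\<^sub>2 (\<lambda>_. 0) \<subseteq> box A e\<close>.\<close>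
  define good where "good = (\<lambda>(A, e). invertible A \<and> box A (\<lambda>_. 0) = box A\<^sub>1 (\<lambda>_. 0) \<and>
      (\<forall>j l. ord_ge (e j) ((A ** C) $ j $ l)))"
  obtain k0 where k0: "\<And>i j. ord_ge k0 ((A\<^sub>2 ** C\<^sub>1) $ i $ j)"
    using matrix_entries_lower_bound by metis
  have expand: "(A *v x) = (A ** C) *v (A\<^sub>2 *v x)" for A x
    by (simp add: matrix_vector_mul_assoc matrix_mul_assoc[symmetric] C)
  \<comment> \<open>The vector dual to row \<open>j\<close> lies in the first lattice, hence in
    \<open>\<pi> powi k0\<close> times the second. Row \<open>j\<close> takes the value 1 on it,
    which forces \<open>e j + k0 \<le> 0\<close>.\<close>
  have bound: "e j \<le> - k0" if "good (A, e)" for A e j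
  proof -
    have A: "invertible A" "box A (\<lambda>_. 0) = box A\<^sub>1 (\<lambda>_. 0)" "\<And>j l. ord_ge (e j) ((A ** C) $ j $ l)"
      using that by (auto simp: good_def)
    obtain D where D: "A ** D = mat 1" using A(1) unfolding invertible_def by blast
    let ?x = "column j D"
    have "?x \<in> box A (\<lambda>_. 0)"
      using row_mult_column_inverse[OF D, of j] by (simp add: mem_box ord_ge_def)
    then have x: "\<And>i. ord_ge 0 ((A\<^sub>1 *v ?x) $ i)" using A(2) by (simp add: mem_box)
    have "A\<^sub>2 *v ?x = (A\<^sub>2 ** C\<^sub>1) *v (A\<^sub>1 *v ?x)"
      by (simp add: matrix_vector_mul_assoc matrix_mul_assoc[symmetric] C1)
    then have "ord_ge k0 ((A\<^sub>2 *v ?x) $ i)" for i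
      using ord_ge_matrix_mult_vec[of k0 "A\<^sub>2 ** C\<^sub>1" i 0 "A\<^sub>1 *v ?x"] k0 x by simp
    then have "ord_ge (e j + k0) ((A *v ?x) $ j)"
      unfolding expand[of A] by (intro ord_ge_matrix_mult_vec A)
    then show ?thesis by (simp add: row_mult_column_inverse[OF D] ord_ge_def)
  qed
  \<comment> \<open>By \<open>bound\<close> the sum is nonnegative for good pairs, so
    \<open>nat\<close> truncates nothing and a minimum of \<open>m\<close> is a maximum of the total
    level.\<close>
  define m where "m = (\<lambda>(A :: 'k ^ 'd ^ 'd, e). nat (\<Sum>j\<in>(UNIV :: 'd set). - k0 - e j))"
  obtain k1 where "\<And>i j. ord_ge k1 ((A\<^sub>1 ** C) $ i $ j)"
    using matrix_entries_lower_bound by metis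
  then have "good (A\<^sub>1, \<lambda>_. k1)" using assms by (simp add: good_def)
  from ex_has_least_nat[where m = m, of good, OF this]
  obtain A e where Ae: "good (A, e)" and least: "\<And>A' e'. good (A', e') \<Longrightarrow> m (A, e) \<le> m (A', e')"
    by auto
  then have inv: "invertible A" and A1: "box A (\<lambda>_. 0) = box A\<^sub>1 (\<lambda>_. 0)"
    and e: "\<And>j l. ord_ge (e j) ((A ** C) $ j $ l)"
    by (auto simp: good_def)
  define S where "S = scale_rows (\<lambda>j. - e j) A"
  obtain D where D: "S ** D = mat 1" "D ** S = mat 1"
    using invertible_scale_rows[OF inv] unfolding S_def invertible_def by blast
  define P where "P = A\<^sub>2 ** D"
  have PS: "P ** S = A\<^sub>2" by (simp add: P_def matrix_mul_assoc[symmetric] D)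
  have SC: "(S ** C) $ j $ l = \<pi> powi (- e j) * (A ** C) $ j $ l" for j l
    by (simp add: S_def scale_rows_def matrix_matrix_mult_def sum_distrib_left mult.assoc)
  have SC_ge: "ord_ge 0 ((S ** C) $ j $ l)" for j l
    using e uniformizer_nonzero by (simp add: SC ord_ge_mult_iff)
  \<comment> \<open>The rows of \<open>S\<close> are integral exactly on \<open>box A e\<close>, and
    \<open>P\<close> expresses the rows of \<open>A\<^sub>2\<close> in them. Integrality of
    \<open>P\<close> thus gives the inclusion not contained in \<open>good\<close>.\<close>
  have P_ge: "ord_ge 0 (P $ i $ j)" for i j
  proof (rule ccontr)
    assume neg: "\<not> ord_ge 0 (P $ i $ j)"
    define k where "k = Min ((\<lambda>j. ord (P $ i $ j)) ` {j. P $ i $ j \<noteq> 0})"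
    have k_le: "k \<le> ord (P $ i $ j)" if "P $ i $ j \<noteq> 0" for j
      unfolding k_def using that by (intro Min_le) auto
    have "k < 0" using neg k_le[of j] by (auto simp: ord_ge_def)
    define U where "U = {j. P $ i $ j \<noteq> 0 \<and> ord (P $ i $ j) = k}"
    have "k \<in> (\<lambda>j. ord (P $ i $ j)) ` {j. P $ i $ j \<noteq> 0}"
      unfolding k_def using neg by (intro Min_in) (auto simp: ord_ge_def)
    then have "U \<noteq> {}" by (auto simp: U_def)
    have "\<exists>j0\<in>U. \<forall>j\<in>U. e j \<le> e j0"
    proof -
      have "Max (e ` U) \<in> e ` U" using \<open>U \<noteq> {}\<close> by (intro Max_in) auto
      then obtain j0 where "j0 \<in> U" "e j0 = Max (e ` U)" by auto
      then show ?thesis by (intro bexI[of _ j0]) auto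
    qed
    then obtain j0 where j0: "j0 \<in> U" and j0_max: "\<And>j. j \<in> U \<Longrightarrow> e j \<le> e j0" by blast
    \<comment> \<open>Row \<open>i\<close> of \<open>A\<^sub>2\<close> is a combination of the rows
      of \<open>S\<close> with coefficients from \<open>P\<close>. Only the terms of lowest order
      \<open>k\<close> are kept and rewritten in rows of \<open>A\<close>. On \<open>U\<close> the
      order of \<open>c $ j\<close> becomes \<open>e j0 - e j\<close>, which is nonnegative by
      maximality of \<open>e j0\<close> and zero at \<open>j0\<close>.\<close>
    define c :: "'k ^ 'd" where
      "c = (\<chi> j. if j \<in> U then \<pi> powi (e j0 - e j - k) * P $ i $ j else 0)"
    have c: "c $ j0 \<noteq> 0" "ord (c $ j0) = 0"
      using j0 uniformizer_nonzero by (auto simp: c_def U_def ord_mult)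
    have c_ge: "ord_ge 0 (c $ j)" for j
      using j0_max[of j] uniformizer_nonzero by (auto simp: c_def U_def ord_ge_def ord_mult)
    define A' where "A' = replace_row j0 c A"
    define e' where "e' = e(j0 := e j0 + 1)"
    have A'C: "(A' ** C) $ j $ l = (A' *v column l C) $ j" for A' :: "'k ^ 'd ^ 'd" and j l
      by (simp add: matrix_vector_mult_def matrix_matrix_mult_def column_def)
    have "ord_ge (e j0 + 1) ((A' ** C) $ j0 $ l)" for l
    proof -
      have "(A' ** C) $ j0 $ l = (\<Sum>j\<in>UNIV. c $ j * (A ** C) $ j $ l)"
        by (simp add: A'C A'_def replace_row_mult_vec)
      also have "\<dots> = (\<Sum>j\<in>U. \<pi> powi (e j0 - e j - k) * P $ i $ j * (A ** C) $ j $ l)"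
        by (intro sum.mono_neutral_cong_right) (auto simp: c_def)
      also have "\<dots> = (\<Sum>j\<in>U. \<pi> powi (e j0 - k) * (P $ i $ j * (S ** C) $ j $ l))"
      proof (rule sum.cong[OF refl])
        fix j
        have "\<pi> powi (e j0 - e j - k) = \<pi> powi (e j0 - k) * \<pi> powi (- e j)"
          using uniformizer_nonzero power_int_add[of \<pi> "e j0 - k" "- e j"] by (simp add: algebra_simps)
        then show "\<pi> powi (e j0 - e j - k) * P $ i $ j * (A ** C) $ j $ l =
            \<pi> powi (e j0 - k) * (P $ i $ j * (S ** C) $ j $ l)"
          by (simp add: SC)
      qed
      also have "\<dots> = \<pi> powi (e j0 - k) * (\<Sum>j\<in>U. P $ i $ j * (S ** C) $ j $ l)"
        by (simp add: sum_distrib_left)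
      finally have eq: "(A' ** C) $ j0 $ l = \<dots>" .
      \<comment> \<open>The sum over all \<open>j\<close> is an entry of the identity matrix, and
        \<open>k + 1 \<le> 0\<close>. Terms outside \<open>U\<close> have order at least
        \<open>k + 1\<close>. Hence so has the sum over \<open>U\<close>, one more than its single
        terms guarantee.\<close>
      have "(\<Sum>j\<in>UNIV. P $ i $ j * (S ** C) $ j $ l) = ((P ** S) ** C) $ i $ l"
        unfolding matrix_mul_assoc[symmetric] by (simp add: matrix_matrix_mult_def)
      also have "\<dots> = (mat 1 :: 'k ^ 'd ^ 'd) $ i $ l" by (simp add: PS C)
      also have "ord_ge (k + 1) \<dots>" using \<open>k < 0\<close> by (auto simp: mat_def ord_ge_def)
      finally have all: "ord_ge (k + 1) (\<Sum>j\<in>UNIV. P $ i $ j * (S ** C) $ j $ l)" .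
      have "ord_ge (k + 1) (P $ i $ j)" if "j \<notin> U" for j
        using that k_le[of j] by (cases "P $ i $ j = 0") (auto simp: U_def ord_ge_def)
      then have rest: "ord_ge (k + 1) (\<Sum>j\<in>-U. P $ i $ j * (S ** C) $ j $ l)"
        using ord_ge_mult[OF _ SC_ge, of "k + 1"] by (intro ord_ge_sum) auto
      have "(\<Sum>j\<in>U. P $ i $ j * (S ** C) $ j $ l) =
          (\<Sum>j\<in>UNIV. P $ i $ j * (S ** C) $ j $ l) - (\<Sum>j\<in>-U. P $ i $ j * (S ** C) $ j $ l)"
        by (simp add: sum.subset_diff[of U UNIV] Compl_eq_Diff_UNIV)
      then have "ord_ge (k + 1) (\<Sum>j\<in>U. P $ i $ j * (S ** C) $ j $ l)"
        using ord_ge_diff[OF all rest] by simp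
      then show ?thesis
        unfolding eq using uniformizer_nonzero by (simp add: ord_ge_mult_iff add.commute)
    qed
    moreover have "ord_ge (e j) ((A' ** C) $ j $ l)" if "j \<noteq> j0" for j l
      using e[of j l] that by (simp add: A'C A'_def replace_row_mult_vec)
    ultimately have good': "good (A', e')"
      using A1 inv c c_ge invertible_replace_row[of A c j0] box_replace_row[of c j0 A]
      by (auto simp: good_def A'_def e'_def)
    have "m (A', e') < m (A, e)"
    proof -
      have "(\<Sum>j\<in>UNIV. - k0 - e' j) = (\<Sum>j\<in>UNIV. - k0 - e j) - 1"
        by (simp add: e'_def sum.remove[of UNIV j0])
      moreover have "0 \<le> (\<Sum>j\<in>UNIV. - k0 - e' j)"
        using bound[OF good'] by (intro sum_nonneg) (simp add: algebra_simps)
      ultimately show ?thesis by (simp add: m_def)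
    qed
    then show False using least[OF good'] by simp
  qed
  have "box A e = box A\<^sub>2 (\<lambda>_. 0)"
  proof (intro equalityI subsetI)
    fix x assume "x \<in> box A e"
    then have Sx: "ord_ge 0 ((S *v x) $ j)" for j
      using uniformizer_nonzero by (simp add: mem_box S_def scale_rows_mult_vec ord_ge_mult_iff)
    have "A\<^sub>2 *v x = P *v (S *v x)" by (simp add: matrix_vector_mul_assoc PS)
    then show "x \<in> box A\<^sub>2 (\<lambda>_. 0)"
      using ord_ge_matrix_mult_vec[of 0 P _ 0 "S *v x"] P_ge Sx by (simp add: mem_box)
  next
    fix x assume "x \<in> box A\<^sub>2 (\<lambda>_. 0)"
    then show "x \<in> box A e"
      using ord_ge_matrix_mult_vec[of _ "A ** C" _ 0 "A\<^sub>2 *v x"] e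
      by (auto simp: mem_box expand[of A x])
  qed
  with inv A1 show ?thesis by (rule that)
qed

text \<open>Every selected row is a multiple of a row of \<open>A 1\<close>. On the component of
  \<open>x\<close> along \<open>column j C\<close> it either keeps its value at \<open>x\<close> or
  vanishes.\<close>

lemma spanning_selection_12:
  fixes A :: "nat \<Rightarrow> 'k ^ 'd ^ 'd"
  assumes C: "A 1 ** C = mat 1" and A2: "A 2 = scale_rows e (A 1)"
    and \<sigma>: "\<And>l. fst (\<sigma> l) \<in> {1, 2}"
  shows "spanning (range (\<lambda>j. column j C)) (box (select A \<sigma>) a)"
proof (rule spanning_columns[OF C])
  fix x j assume x: "x \<in> box (select A \<sigma>) a"
  have "ord_ge (a l) ((select A \<sigma> *v ((A 1 *v x) $ j *s column j C)) $ l)" for l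
  proof (cases "snd (\<sigma> l) = j")
    case True
    then have "(select A \<sigma> *v ((A 1 *v x) $ j *s column j C)) $ l = (select A \<sigma> *v x) $ l"
      using \<sigma>[of l] by (auto simp: select_mult_vec A2 scale_rows_mult_vec mult_scaled_column[OF C] simp del: One_nat_def)
    then show ?thesis using x by (simp add: mem_box)
  next
    case False
    then have "(select A \<sigma> *v ((A 1 *v x) $ j *s column j C)) $ l = 0"
      using \<sigma>[of l] by (auto simp: select_mult_vec A2 scale_rows_mult_vec mult_scaled_column[OF C] simp del: One_nat_def)
    then show ?thesis by simp
  qed
  then show "(A 1 *v x) $ j *s column j C \<in> box (select A \<sigma>) a" by (simp add: mem_box)
qed

lemma zero_not_in_columns:
  fixes C :: "'k ^ 'd ^ 'd"
  assumes "A ** C = mat 1"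
  shows "0 \<notin> range (\<lambda>j. column j C)"
proof
  assume "0 \<in> range (\<lambda>j. column j C)"
  then obtain j where "column j C = 0" by auto
  then show False using row_mult_column_inverse[OF assms, of j j] by simp
qed

lemma card_columns_le:
  fixes C :: "'k ^ 'd ^ 'd"
  shows "card (range (\<lambda>j. column j C)) \<le> CARD('d)"
  by (rule card_image_le) simp

lemma is_lattice_inter:
  fixes A :: "nat \<Rightarrow> 'k ^ 'd ^ 'd"
  assumes "finite I" "i \<in> I" "invertible (A i)"
  shows "is_lattice v (inter I A a)"
proof -
  obtain \<sigma> where \<sigma>: "\<sigma> \<in> selections I A"
    and "\<And>\<tau>. \<tau> \<in> selections I A \<Longrightarrow> excess A a \<sigma> \<le> excess A a \<tau>"
    using excess_minimizer_exists[where A = A and i = i and a = a, OF assms] by blast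
  then have "inter I A a = box (select A \<sigma>) (\<lambda>l. a (fst (\<sigma> l)))"
    by (rule inter_eq_box_select)
  moreover have "invertible (select A \<sigma>)" using \<sigma> by (simp add: selections_def invertible_det_nz)
  ultimately show ?thesis by (simp add: is_lattice_box)
qed

text \<open>The binomial estimate assumes \<open>2 \<le> d\<close>. On a line every vector is a
  multiple of one basis vector, which therefore spans all intersections.\<close>

lemma common_spanning_set_dim_1:
  fixes A :: "nat \<Rightarrow> 'k ^ 'd ^ 'd"
  assumes "CARD('d) = 1" "invertible (A 1)"
  obtains X where "finite X" "X \<noteq> {}" "0 \<notin> X" "card X \<le> 1" "\<And>a. spanning X (inter I A a)"
proof -
  obtain C where C: "A 1 ** C = mat 1" using assms(2) unfolding invertible_def by blast
  let ?X = "range (\<lambda>j. column j C)"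
  have "spanning ?X (inter I A a)" for a
  proof (rule spanning_columns[OF C])
    fix x and j :: 'd assume x: "x \<in> inter I A a"
    obtain b :: 'd where b: "UNIV = {b}" using assms(1) by (rule card_1_singletonE)
    have "j = b" using UNIV_I[of j] unfolding b by (rule singletonD)
    with b have UNIV: "UNIV = {j}" by (simp only:)
    have "x = (\<Sum>j\<in>UNIV. (A 1 *v x) $ j *s column j C)"
      using C matrix_left_right_inverse column_expansion by blast
    also have "\<dots> = (A 1 *v x) $ j *s column j C" unfolding UNIV by simp
    finally show "(A 1 *v x) $ j *s column j C \<in> inter I A a" using x by simp
  qed
  then show ?thesis
    using that[of ?X] zero_not_in_columns[OF C] card_columns_le[of C] assms(1) by simp
qed

text \<open>
  All selections from the first two matrices can share one basis, since these matrices have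
  proportional rows.
\<close>

lemma common_spanning_set:
  fixes A :: "nat \<Rightarrow> 'k ^ 'd ^ 'd"
  assumes s: "2 \<le> s" and inv: "\<And>i. i \<in> {1..s} \<Longrightarrow> invertible (A i)"
    and A2: "A 2 = scale_rows e (A 1)"
  obtains X where "finite X" "X \<noteq> {}" "0 \<notin> X"
    "card X + CARD('d) * CARD('d) \<le> CARD('d) * ((CARD('d) + s - 1) choose CARD('d))"
    "\<And>a. spanning X (inter {1..s} A a)"
proof -
  let ?d = "CARD('d)"
  obtain \<tau> :: "nat multiset \<Rightarrow> 'd \<Rightarrow> nat \<times> 'd" where
    \<tau>: "\<And>a. \<exists>m\<in>multisets_of_size {1..s} CARD('d). \<tau> m \<in> selections {1..s} A \<and> profile (\<tau> m) = m \<and>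
       inter {1..s} A a = box (select A (\<tau> m)) (\<lambda>l. a (fst (\<tau> m l)))"
    using profile_representatives[of "{1..s}" 1 A] s inv[of 1] by auto
  obtain C0 where C0: "A 1 ** C0 = mat 1" using inv[of 1] s unfolding invertible_def by auto
  \<comment> \<open>\<open>M\<close> collects the profiles that use a matrix beyond the first two.
    All other profiles are served by the shared basis \<open>X0\<close>.\<close>
  define M where "M = {m \<in> multisets_of_size {1..s} ?d - multisets_of_size {1, 2} ?d. \<tau> m \<in> selections {1..s} A}"
  have "\<exists>C. select A (\<tau> m) ** C = mat 1" if "m \<in> M" for m
    using that unfolding M_def selections_def invertible_det_nz[symmetric] invertible_def by blast
  then obtain C where C: "\<And>m. m \<in> M \<Longrightarrow> select A (\<tau> m) ** C m = mat 1" by metis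
  define X0 where "X0 = range (\<lambda>j. column j C0)"
  define X1 where "X1 m = range (\<lambda>j. column j (C m))" for m
  define X where "X = X0 \<union> (\<Union>m\<in>M. X1 m)"
  have fin: "finite (multisets_of_size {1..s} ?d)" by auto
  have "finite M" unfolding M_def using fin by simp
  then have finX: "finite X" unfolding X_def X0_def X1_def
    by (intro finite_UnI finite_UN_I finite_imageI) simp_all
  \<comment> \<open>There are \<open>?d + 1\<close> multisets of size \<open>?d\<close> over two
    elements. One basis in place of \<open>?d + 1\<close> saves \<open>?d * ?d\<close> vectors in
    the count.\<close>
  have card_M: "card M + (?d + 1) \<le> (?d + s - 1) choose ?d"
  proof -
    have sub: "multisets_of_size {1, 2} ?d \<subseteq> multisets_of_size {1..s} ?d"
      using s by (intro multisets_of_size_mono) auto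
    have "card M \<le> card (multisets_of_size {1..s} ?d - multisets_of_size {1, 2} ?d)"
      using fin by (intro card_mono) (auto simp: M_def)
    also have "\<dots> = card (multisets_of_size {1..s} ?d) - card (multisets_of_size {1, 2 :: nat} ?d)"
      using finite_subset[OF sub fin] sub by (rule card_Diff_subset)
    finally have "card M + card (multisets_of_size {1, 2 :: nat} ?d) \<le> card (multisets_of_size {1..s} ?d)"
      using card_mono[OF fin sub] by simp
    then show ?thesis by (simp add: card_multisets_of_size add.commute)
  qed
  have "card X \<le> card X0 + card (\<Union>m\<in>M. X1 m)" unfolding X_def by (rule card_Un_le)
  also have "card (\<Union>m\<in>M. X1 m) \<le> (\<Sum>m\<in>M. card (X1 m))" using \<open>finite M\<close> by (rule card_UN_le)
  also have "\<dots> \<le> (\<Sum>m\<in>M. ?d)" unfolding X1_def by (intro sum_mono card_columns_le)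
  also have "card X0 \<le> ?d" unfolding X0_def by (rule card_columns_le)
  finally have "card X \<le> ?d + card M * ?d" by simp
  then have "card X + ?d * ?d \<le> ?d * (card M + (?d + 1))" by (simp add: algebra_simps)
  also have "\<dots> \<le> ?d * ((?d + s - 1) choose ?d)" using card_M by (rule mult_left_mono) simp
  finally have cardX: "card X + ?d * ?d \<le> \<dots>" .
  have "spanning X (inter {1..s} A a)" for a
  proof -
    obtain m where m: "m \<in> multisets_of_size {1..s} ?d" "\<tau> m \<in> selections {1..s} A" "profile (\<tau> m) = m"
      and inter: "inter {1..s} A a = box (select A (\<tau> m)) (\<lambda>l. a (fst (\<tau> m l)))"
      using \<tau> by blast
    show ?thesis
    proof (cases "m \<in> multisets_of_size {1, 2} ?d")
      case True
      have "fst (\<tau> m l) \<in> {1, 2}" for l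
        using in_profile[of "\<tau> m" l] multisets_of_size_subset[OF True] unfolding m(3) by blast
      then have "spanning X0 (inter {1..s} A a)"
        unfolding inter X0_def by (intro spanning_selection_12[OF C0 A2])
      then show ?thesis
        by (rule spanning_mono[OF _ _ finX zero_in_inter]) (auto simp: X_def)
    next
      case False
      then have "m \<in> M" using m by (simp add: M_def)
      then have "spanning (X1 m) (inter {1..s} A a)"
        unfolding inter X1_def by (intro spanning_box C)
      then show ?thesis
        by (rule spanning_mono[OF _ _ finX zero_in_inter]) (use \<open>m \<in> M\<close> in \<open>auto simp: X_def\<close>)
    qed
  qed
  moreover have "0 \<notin> X"
    using zero_not_in_columns[OF C0] zero_not_in_columns[OF C] by (auto simp: X_def X0_def X1_def)
  moreover have "X \<noteq> {}" by (simp add: X_def X0_def)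
  ultimately show ?thesis using that finX cardX by blast
qed

lemma box_shift: "box A (\<lambda>j. a j + k) = {x. \<pi> powi (- k) *s x \<in> box A a}"
  using uniformizer_nonzero
  by (simp add: box_def vec.linear_scale[OF matrix_vector_mul_linear_gen] ord_ge_mult_iff)

lemma lattices_common_spanning_set:
  fixes \<Lambda> :: "nat \<Rightarrow> ('k ^ 'd) set"
  assumes s: "3 \<le> s" and \<Lambda>: "\<And>i. i \<in> {1..s} \<Longrightarrow> is_lattice v (\<Lambda> i)"
  obtains A X where "\<And>i. i \<in> {1..s} \<Longrightarrow> invertible (A i) \<and> \<Lambda> i = box (A i) (\<lambda>_. 0)"
    "finite X" "X \<noteq> {}" "0 \<notin> X" "card X \<le> CARD('d) * 2 ^ CARD('d) * fact CARD('d) ^ (s - 3)"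
    "\<And>a. spanning X (inter {1..s} A a)"
proof -
  let ?d = "CARD('d)"
  have "\<exists>B. invertible B \<and> \<Lambda> i = box B (\<lambda>_. 0)" if "i \<in> {1..s}" for i
    using is_lattice_imp_box[OF \<Lambda>[OF that]] by metis
  then obtain B where B: "\<And>i. i \<in> {1..s} \<Longrightarrow> invertible (B i)"
    "\<And>i. i \<in> {1..s} \<Longrightarrow> \<Lambda> i = box (B i) (\<lambda>_. 0)" by metis
  obtain A0 e where A0: "invertible A0" "box A0 (\<lambda>_. 0) = box (B 1) (\<lambda>_. 0)"
    "box A0 e = box (B 2) (\<lambda>_. 0)"
    using common_apartment[OF B(1)[of 1] B(1)[of 2]] s by auto
  \<comment> \<open>The first two matrices are replaced by matrices with proportional rows. Scaling
    by \<open>\<pi> powi (- e j)\<close> turns the levels \<open>e\<close> of the second lattice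
    into zero.\<close>
  define A where "A = B(1 := A0, 2 := scale_rows (\<lambda>j. - e j) A0)"
  have A2: "A 2 = scale_rows (\<lambda>j. - e j) (A 1)" by (simp add: A_def)
  have inv: "invertible (A i)" if "i \<in> {1..s}" for i
    using B(1)[OF that] A0(1) invertible_scale_rows[OF A0(1)] by (simp add: A_def)
  have \<Lambda>A: "\<Lambda> i = box (A i) (\<lambda>_. 0)" if "i \<in> {1..s}" for i
    using B(2)[OF that] A0(2,3) by (simp add: A_def box_scale_rows)
  have "\<exists>X. finite X \<and> X \<noteq> {} \<and> 0 \<notin> X \<and> card X \<le> ?d * 2 ^ ?d * fact ?d ^ (s - 3) \<and>
      (\<forall>a. spanning X (inter {1..s} A a))"
  proof (cases "?d = 1")
    case True
    have inv1: "invertible (A 1)" using inv[of 1] s by simp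
    obtain X where "finite X" "X \<noteq> {}" "0 \<notin> X" "card X \<le> 1" "\<And>a. spanning X (inter {1..s} A a)"
      using common_spanning_set_dim_1[where A = A and I = "{1..s}", OF True inv1] by blast
    then show ?thesis using True by (intro exI[of _ X]) simp
  next
    case False
    have s2: "2 \<le> s" using s by simp
    have "0 < ?d" by simp
    with False have d: "2 \<le> ?d" by linarith
    obtain X where X: "finite X" "X \<noteq> {}" "0 \<notin> X"
      "card X + ?d * ?d \<le> ?d * ((?d + s - 1) choose ?d)" "\<And>a. spanning X (inter {1..s} A a)"
      using common_spanning_set[where A = A and s = s, OF s2 inv A2] by blast
    have "?d * ((?d + s - 1) choose ?d) \<le> ?d * (2 ^ ?d * fact ?d ^ (s - 3) + ?d)"
      using choose_le_power2_fact[OF d s] by (rule mult_left_mono) simp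
    then have "card X \<le> ?d * 2 ^ ?d * fact ?d ^ (s - 3)"
      using X(4) by (simp add: algebra_simps)
    then show ?thesis using X by blast
  qed
  then show ?thesis using that inv \<Lambda>A by blast
qed

section \<open>Lattice classes and convex hulls\<close>

definition shift :: "int \<Rightarrow> ('k ^ 'd) set \<Rightarrow> ('k ^ 'd) set" where
  "shift k L = scale_set (\<pi> powi k) L"

lemma mem_scale_set: "c \<noteq> 0 \<Longrightarrow> x \<in> scale_set c L \<longleftrightarrow> inverse c *s x \<in> L"
  by (force simp: scale_set_def image_iff vec.scale_scale)

lemma mem_shift: "x \<in> shift k L \<longleftrightarrow> \<pi> powi (- k) *s x \<in> L"
  using uniformizer_nonzero by (simp add: shift_def mem_scale_set power_int_minus)

lemma shift_shift [simp]: "shift k (shift l L) = shift (k + l) L"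
  using uniformizer_nonzero by (auto simp: mem_shift add.commute simp flip: power_int_add)

lemma shift_0 [simp]: "shift 0 L = L"
  by (auto simp: mem_shift)

lemma shift_box: "shift k (box A a) = box A (\<lambda>j. a j + k)"
  by (auto simp: mem_shift box_shift)

lemma shift_inter: "shift k (inter I A a) = inter I A (\<lambda>i. a i + k)"
  by (auto simp: mem_shift inter_def box_shift[where a = "\<lambda>_. a _"])

lemma scale_set_uniformizer: "scale_set \<pi> L = shift 1 L"
  by (simp add: shift_def)

lemma is_lattice_shift: "is_lattice v L \<Longrightarrow> is_lattice v (shift k L)"
  by (auto elim!: is_lattice_imp_box simp: shift_box intro: is_lattice_box)

text \<open>Units of the valuation ring preserve every lattice, so only the order of the scalar
  matters. This makes a lattice class the orbit of any member under \<open>shift\<close>.\<close>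

lemma scale_set_lattice:
  assumes "is_lattice v L" "c \<noteq> 0"
  shows "scale_set c L = shift (ord c) L"
proof -
  obtain A where L: "L = box A (\<lambda>_. 0)" using assms(1) by (rule is_lattice_imp_box)
  show ?thesis
    unfolding L shift_box using assms(2)
    by (auto simp: mem_scale_set mem_box vec.linear_scale[OF matrix_vector_mul_linear_gen]
        ord_ge_mult_iff ord_inverse)
qed

lemma lattice_class_eq_shifts:
  assumes "is_lattice v L"
  shows "lattice_class v L = range (\<lambda>k. shift k L)"
proof (intro equalityI subsetI)
  fix L' assume "L' \<in> lattice_class v L"
  then obtain c where c: "is_lattice v L'" "c \<noteq> 0" "L = scale_set c L'"
    by (auto simp: lattice_class_def lattice_rel_def)
  then have "L' = shift (- ord c) L" by (simp add: scale_set_lattice)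
  then show "L' \<in> range (\<lambda>k. shift k L)" by blast
next
  fix L' assume "L' \<in> range (\<lambda>k. shift k L)"
  then obtain k where k: "L' = shift k L" by blast
  then have "L = scale_set (\<pi> powi (- k)) L'" by (simp flip: shift_def)
  then show "L' \<in> lattice_class v L"
    using k assms is_lattice_shift uniformizer_nonzero
    by (auto simp: lattice_class_def lattice_rel_def intro!: exI[of _ "\<pi> powi (- k)"])
qed

lemma lattice_class_eq_iff:
  assumes "is_lattice v L" "is_lattice v L'"
  shows "lattice_class v L = lattice_class v L' \<longleftrightarrow> (\<exists>k. L' = shift k L)"
proof
  assume "lattice_class v L = lattice_class v L'"
  moreover have "L' \<in> lattice_class v L'"
    unfolding lattice_class_eq_shifts[OF assms(2)] by (rule range_eqI[of _ _ 0]) simp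
  ultimately show "\<exists>k. L' = shift k L"
    unfolding lattice_class_eq_shifts[OF assms(1)] by blast
next
  assume "\<exists>k. L' = shift k L"
  then obtain k where k: "L' = shift k L" ..
  have "shift m L \<in> range (\<lambda>k. shift k L')" for m by (rule range_eqI[of _ _ "m - k"]) (simp add: k)
  moreover have "shift m L' \<in> range (\<lambda>k. shift k L)" for m by (simp add: k)
  ultimately show "lattice_class v L = lattice_class v L'"
    unfolding assms[THEN lattice_class_eq_shifts] by blast
qed

lemma lattice_class_in_lattice_classes:
  "is_lattice v L \<Longrightarrow> lattice_class v L \<in> lattice_classes v"
  by (simp add: lattice_class_def lattice_classes_def quotientI)

lemma lattice_sum_mem:
  assumes "is_lattice v L" "\<And>f. f \<in> X \<Longrightarrow> g f \<in> L"
  shows "sum g X \<in> L"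
proof -
  obtain A where L: "L = box A (\<lambda>_. 0)" using assms(1) by (rule is_lattice_imp_box)
  show ?thesis
    using assms(2) unfolding L
    by (auto simp: mem_box vec.linear_sum[OF matrix_vector_mul_linear_gen] intro!: ord_ge_sum)
qed

section \<open>Levels of vectors with respect to lattices\<close>

definition level :: "('k ^ 'd) set \<Rightarrow> 'k ^ 'd \<Rightarrow> int" where
  "level L f = (THE k. \<forall>c. c \<noteq> 0 \<longrightarrow> (c *s f \<in> L \<longleftrightarrow> - k \<le> ord c))"

lemma level_eqI:
  assumes "\<And>c. c \<noteq> 0 \<Longrightarrow> c *s f \<in> L \<longleftrightarrow> - k \<le> ord c"
  shows "level L f = k"
  unfolding level_def
proof (rule the_equality)
  fix l assume "\<forall>c. c \<noteq> 0 \<longrightarrow> (c *s f \<in> L \<longleftrightarrow> - l \<le> ord c)"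
  then have "- k \<le> m \<longleftrightarrow> - l \<le> m" for m
    using assms[of "\<pi> powi m"] uniformizer_nonzero by (auto dest: spec[of _ "\<pi> powi m"])
  from this[of "- k"] this[of "- l"] show "l = k" by simp
qed (use assms in blast)

text \<open>For \<open>L = box A (\<lambda>_. 0)\<close> the level is the least order of a nonzero
  coordinate of \<open>A *v f\<close>. Such a coordinate exists because \<open>A\<close> is
  invertible and \<open>f\<close> is nonzero, so the description in \<open>level\<close> is
  satisfied.\<close>

lemma smult_mem_lattice_iff:
  fixes f :: "'k ^ 'd"
  assumes "is_lattice v L" "f \<noteq> 0" "c \<noteq> 0"
  shows "c *s f \<in> L \<longleftrightarrow> - level L f \<le> ord c"
proof -
  obtain A where A: "invertible A" and L: "L = box A (\<lambda>_. 0)"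
    using assms(1) by (rule is_lattice_imp_box)
  define J where "J = {j. (A *v f) $ j \<noteq> 0}"
  have "A *v f \<noteq> 0"
    using A assms(2) unfolding invertible_left_inverse matrix_left_invertible_ker by blast
  then have J: "J \<noteq> {}" by (auto simp: J_def vec_eq_iff)
  let ?k = "Min ((\<lambda>j. ord ((A *v f) $ j)) ` J)"
  have iff: "c *s f \<in> L \<longleftrightarrow> - ?k \<le> ord c" if "c \<noteq> 0" for c
  proof -
    have "c *s f \<in> L \<longleftrightarrow> (\<forall>j. ord_ge (- ord c) ((A *v f) $ j))"
      using that by (simp add: L mem_box vec.linear_scale[OF matrix_vector_mul_linear_gen] ord_ge_mult_iff)
    also have "\<dots> \<longleftrightarrow> (\<forall>j\<in>J. - ord c \<le> ord ((A *v f) $ j))"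
      by (auto simp: J_def ord_ge_def)
    also have "\<dots> \<longleftrightarrow> - ord c \<le> ?k" using J by simp
    finally show ?thesis by linarith
  qed
  then show ?thesis using level_eqI[of f L ?k] assms(3) by simp
qed

lemma level_shift:
  fixes f :: "'k ^ 'd"
  assumes "is_lattice v L" "f \<noteq> 0"
  shows "level (shift k L) f = level L f - k"
proof (rule level_eqI)
  fix c :: 'k assume "c \<noteq> 0"
  then have "c *s f \<in> shift k L \<longleftrightarrow> - level L f \<le> ord (\<pi> powi (- k) * c)"
    using smult_mem_lattice_iff[OF assms, of "\<pi> powi (- k) * c"] uniformizer_nonzero
    by (simp add: mem_shift vec.scale_scale)
  also have "ord (\<pi> powi (- k) * c) = ord c - k"
    using \<open>c \<noteq> 0\<close> uniformizer_nonzero by (simp add: ord_mult)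
  finally show "c *s f \<in> shift k L \<longleftrightarrow> - (level L f - k) \<le> ord c" by auto
qed

lemma level_inter:
  fixes f :: "'k ^ 'd"
  assumes I: "finite I" "I \<noteq> {}" and A: "\<And>i. i \<in> I \<Longrightarrow> invertible (A i)" and f: "f \<noteq> 0"
  shows "level (inter I A a) f = Min ((\<lambda>i. level (box (A i) (\<lambda>_. 0)) f - a i) ` I)"
    (is "_ = Min (?g ` I)")
proof (rule level_eqI)
  fix c :: 'k assume c: "c \<noteq> 0"
  have "c *s f \<in> box (A i) (\<lambda>_. a i) \<longleftrightarrow> - ord c \<le> ?g i" if "i \<in> I" for i
  proof -
    have L: "is_lattice v (box (A i) (\<lambda>_. 0))" using A[OF that] by (rule is_lattice_box)
    have "c *s f \<in> box (A i) (\<lambda>_. a i) \<longleftrightarrow> - level (shift (a i) (box (A i) (\<lambda>_. 0))) f \<le> ord c"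
      using smult_mem_lattice_iff[OF is_lattice_shift[OF L] f c, of "a i"] by (simp add: shift_box)
    then show ?thesis unfolding level_shift[OF L f] by auto
  qed
  then have "c *s f \<in> inter I A a \<longleftrightarrow> (\<forall>i\<in>I. - ord c \<le> ?g i)" by (simp add: inter_def)
  also have "\<dots> \<longleftrightarrow> - ord c \<le> Min (?g ` I)" using I by simp
  finally show "c *s f \<in> inter I A a \<longleftrightarrow> - Min (?g ` I) \<le> ord c" by linarith
qed

text \<open>From left to right, \<open>\<pi> powi (- level L f)\<close> times \<open>f\<close> is
  tested. Conversely, \<open>x\<close> splits into multiples of elements of \<open>X\<close> that
  lie in \<open>L\<close>, and the inequality of levels puts each summand into
  \<open>L'\<close>.\<close>

lemma subset_iff_level_le:
  fixes X :: "('k ^ 'd) set"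
  assumes L: "is_lattice v L" and L': "is_lattice v L'" and X: "spanning X L" "0 \<notin> X"
  shows "L \<subseteq> L' \<longleftrightarrow> (\<forall>f\<in>X. level L f \<le> level L' f)"
proof
  assume sub: "L \<subseteq> L'"
  show "\<forall>f\<in>X. level L f \<le> level L' f"
  proof
    fix f assume "f \<in> X"
    then have f: "f \<noteq> 0" using X(2) by blast
    let ?c = "\<pi> powi (- level L f)"
    have c: "?c \<noteq> 0" using uniformizer_nonzero by simp
    have "?c *s f \<in> L" using smult_mem_lattice_iff[OF L f c] by simp
    then have "?c *s f \<in> L'" using sub by blast
    then show "level L f \<le> level L' f" using smult_mem_lattice_iff[OF L' f c] by simp
  qed
next
  assume le: "\<forall>f\<in>X. level L f \<le> level L' f"
  show "L \<subseteq> L'"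
  proof
    fix x assume "x \<in> L"
    then obtain y where y: "x = (\<Sum>f\<in>X. y f *s f)" "\<And>f. f \<in> X \<Longrightarrow> y f *s f \<in> L"
      using X(1) unfolding spanning_def by blast
    have "y f *s f \<in> L'" if "f \<in> X" for f
    proof (cases "y f = 0")
      case True
      then show ?thesis using lattice_sum_mem[OF L', of "{}"] by simp
    next
      case False
      have "f \<noteq> 0" using that X(2) by blast
      then show ?thesis
        using smult_mem_lattice_iff[OF L _ False, of f] smult_mem_lattice_iff[OF L' _ False, of f]
          y(2)[OF that] le that by force
    qed
    then show "x \<in> L'" unfolding y(1) by (rule lattice_sum_mem[OF L'])
  qed
qed

section \<open>The convex hull as the classes of intersections of shifts\<close>

lemma box_in_inters:
  fixes A :: "nat \<Rightarrow> 'k ^ 'd ^ 'd"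
  assumes "i0 \<in> I" "invertible (A i0)"
  obtains a where "box (A i0) (\<lambda>_. 0) = inter I A a"
proof -
  obtain C where C: "C ** A i0 = mat 1" using assms(2) unfolding invertible_left_inverse by blast
  have "\<exists>k. \<forall>j l. ord_ge k ((A i ** C) $ j $ l)" for i
    using matrix_entries_lower_bound by metis
  then obtain k where k: "\<And>i j l. ord_ge (k i) ((A i ** C) $ j $ l)" by metis
  \<comment> \<open>The shift \<open>k i\<close> is low enough for
    \<open>box (A i) (\<lambda>_. k i)\<close> to contain \<open>box (A i0) (\<lambda>_. 0)\<close>,
    so only the lattice of index \<open>i0\<close> constrains the intersection.\<close>
  define a where "a i = (if i = i0 then 0 else k i)" for i
  have "x \<in> box (A i) (\<lambda>_. a i)" if "x \<in> box (A i0) (\<lambda>_. 0)" for i x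
  proof (cases "i = i0")
    case False
    have "A i *v x = (A i ** C) *v (A i0 *v x)"
      by (simp add: matrix_vector_mul_assoc matrix_mul_assoc[symmetric] C)
    then show ?thesis
      using ord_ge_matrix_mult_vec[of "k i" "A i ** C" _ 0 "A i0 *v x"] k that False
      by (simp add: mem_box a_def)
  qed (use that in \<open>simp add: a_def\<close>)
  moreover have "x \<in> box (A i0) (\<lambda>_. 0)" if "x \<in> inter I A a" for x
    using that assms(1) by (auto simp: inter_def a_def)
  ultimately have "box (A i0) (\<lambda>_. 0) = inter I A a" by (auto simp: inter_def)
  then show ?thesis by (rule that)
qed

text \<open>A larger shift gives a smaller lattice, so among the shifts of each single lattice the
  largest one prevails.\<close>

lemma Inter_inters:
  assumes "finite S" "S \<noteq> {}"
  shows "\<Inter> (inter I A ` S) = inter I A (\<lambda>i. Max ((\<lambda>a. a i) ` S))"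
proof -
  have "ord_ge (Max ((\<lambda>a. a i) ` S)) x \<longleftrightarrow> (\<forall>a\<in>S. ord_ge (a i) x)" for i x
    using assms by (auto simp: ord_ge_def)
  then show ?thesis by (auto simp: inter_def mem_box)
qed

text \<open>Representatives of the classes on the right are again intersections of shifts, and these
  are closed under intersection by \<open>Inter_inters\<close>. The set is minimal because each such
  intersection only involves representatives of the given classes.\<close>

lemma lattice_conv_eq:
  fixes A :: "nat \<Rightarrow> 'k ^ 'd ^ 'd"
  assumes I: "finite I" "I \<noteq> {}" and A: "\<And>i. i \<in> I \<Longrightarrow> invertible (A i)"
  shows "lattice_conv v ((\<lambda>i. box (A i) (\<lambda>_. 0)) ` I) = range (\<lambda>a. lattice_class v (inter I A a))"
  unfolding lattice_conv_def
proof (rule hull_unique)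
  let ?C = "range (\<lambda>a. lattice_class v (inter I A a))"
  have lat: "is_lattice v (inter I A a)" for a
    using I A is_lattice_inter by blast
  show "lattice_class v ` (\<lambda>i. box (A i) (\<lambda>_. 0)) ` I \<subseteq> ?C"
  proof clarify
    fix i assume i: "i \<in> I"
    obtain a where "box (A i) (\<lambda>_. 0) = inter I A a" by (rule box_in_inters[where A = A and I = I, OF i A[OF i]])
    then show "lattice_class v (box (A i) (\<lambda>_. 0)) \<in> ?C" by simp
  qed
  show "convex_classes v ?C"
    unfolding convex_classes_def
  proof (intro conjI allI impI; (elim conjE)?)
    show "?C \<subseteq> lattice_classes v" using lat lattice_class_in_lattice_classes by blast
    fix F assume F: "finite F" "F \<noteq> {}" "F \<subseteq> \<Union> ?C"
    have "\<exists>a. L = inter I A a" if "L \<in> F" for L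
      using that F(3) by (auto simp: lattice_class_eq_shifts[OF lat] shift_inter)
    then obtain a where a: "\<And>L. L \<in> F \<Longrightarrow> L = inter I A (a L)" by metis
    then have "F = inter I A ` (a ` F)" by force
    then have "\<Inter> F = inter I A (\<lambda>i. Max ((\<lambda>b. b i) ` a ` F))"
      using Inter_inters[of "a ` F" I A] F(1,2) by simp
    then show "lattice_class v (\<Inter> F) \<in> ?C" by simp
  qed
  fix D assume sub: "lattice_class v ` (\<lambda>i. box (A i) (\<lambda>_. 0)) ` I \<subseteq> D" and D: "convex_classes v D"
  show "?C \<subseteq> D"
  proof
    fix c assume "c \<in> ?C"
    then obtain a where c: "c = lattice_class v (inter I A a)" by blast
    let ?F = "(\<lambda>i. box (A i) (\<lambda>_. a i)) ` I"
    have "?F \<subseteq> \<Union> D"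
    proof clarify
      fix i assume i: "i \<in> I"
      have "box (A i) (\<lambda>_. a i) \<in> lattice_class v (box (A i) (\<lambda>_. 0))"
        unfolding lattice_class_eq_shifts[OF is_lattice_box[OF A[OF i]]]
        by (rule range_eqI[of _ _ "a i"]) (simp add: shift_box)
      moreover have "lattice_class v (box (A i) (\<lambda>_. 0)) \<in> D" using sub i by blast
      ultimately show "box (A i) (\<lambda>_. a i) \<in> \<Union> D" by (rule UnionI[rotated])
    qed
    moreover have "finite ?F" "?F \<noteq> {}" using I by simp_all
    ultimately have "lattice_class v (\<Inter> ?F) \<in> D" using D unfolding convex_classes_def by blast
    then show "c \<in> D" by (simp add: c inter_def)
  qed
qed

end

section \<open>Integral points of tropical lattice polytopes\<close>

lemma Union_induced_flag_complex: "\<Union> (induced_subcomplex (flag_complex V E) W) = V \<inter> W"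
proof (intro equalityI subsetI)
  fix x assume "x \<in> V \<inter> W"
  then have "{x} \<in> induced_subcomplex (flag_complex V E) W"
    by (auto simp: induced_subcomplex_def flag_complex_def)
  then show "x \<in> \<Union> (induced_subcomplex (flag_complex V E) W)" by blast
qed (auto simp: induced_subcomplex_def flag_complex_def)

text \<open>Flag complexes are determined by vertices and edges, so only the bijection and adjacency
  have to be checked.\<close>

lemma simplicial_isomorphic_induced_flag:
  assumes f: "bij_betw f (V \<inter> W) (V' \<inter> W')"
    and E: "\<And>x y. x \<in> V \<inter> W \<Longrightarrow> y \<in> V \<inter> W \<Longrightarrow> x \<noteq> y \<Longrightarrow> E x y \<longleftrightarrow> E' (f x) (f y)"
  shows "simplicial_isomorphic (induced_subcomplex (flag_complex V E) W)
    (induced_subcomplex (flag_complex V' E') W')"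
  unfolding simplicial_isomorphic_def Union_induced_flag_complex
proof (intro exI[of _ f] conjI allI impI f)
  fix \<sigma> assume \<sigma>: "\<sigma> \<subseteq> V \<inter> W"
  have inj: "inj_on f \<sigma>" using f \<sigma> by (auto simp: bij_betw_def intro: inj_on_subset)
  have "f ` \<sigma> \<subseteq> V' \<inter> W'" using f \<sigma> by (auto simp: bij_betw_def)
  moreover have "finite (f ` \<sigma>) \<longleftrightarrow> finite \<sigma>" using inj by (rule finite_image_iff)
  moreover have "(\<forall>x\<in>\<sigma>. \<forall>y\<in>\<sigma>. x \<noteq> y \<longrightarrow> E x y) \<longleftrightarrow> (\<forall>x\<in>\<sigma>. \<forall>y\<in>\<sigma>. f x \<noteq> f y \<longrightarrow> E' (f x) (f y))"
    using E \<sigma> inj by (metis inj_onD subsetD)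
  ultimately show "\<sigma> \<in> induced_subcomplex (flag_complex V E) W \<longleftrightarrow>
      f ` \<sigma> \<in> induced_subcomplex (flag_complex V' E') W'"
    using \<sigma> by (auto simp: induced_subcomplex_def flag_complex_def)
qed

section \<open>Integer vectors and their tropical points\<close>

definition int_vec :: "nat \<Rightarrow> (nat \<Rightarrow> int) \<Rightarrow> nat \<Rightarrow> ereal" where
  "int_vec n h = (\<lambda>i\<in>{..<n}. ereal (of_int (h i)))"

lemma int_vec_nth [simp]: "i < n \<Longrightarrow> int_vec n h i = ereal (of_int (h i))"
  by (simp add: int_vec_def)

lemma int_vec_in_integer_vectors: "int_vec n h \<in> integer_vectors n"
  by (auto simp: integer_vectors_def int_vec_def)

lemma integer_vector_eq_int_vec:
  assumes "x \<in> integer_vectors n"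
  obtains h where "x = int_vec n h"
proof -
  have "\<exists>z::int. x i = ereal (of_int z)" if "i < n" for i
    using assms that by (auto simp: integer_vectors_def PiE_def Pi_def)
  then obtain h :: "nat \<Rightarrow> int" where h: "\<And>i. i < n \<Longrightarrow> x i = ereal (of_int (h i))" by metis
  have "x = int_vec n h"
    using assms h by (intro extensionalityI[of _ "{..<n}"]) (auto simp: integer_vectors_def int_vec_def PiE_def)
  then show ?thesis by (rule that)
qed

lemma int_vec_in_trop_vectors: "1 \<le> n \<Longrightarrow> int_vec n h \<in> trop_vectors n"
  by (auto simp: trop_vectors_def int_vec_def intro!: exI[of _ 0])

lemma trop_rel_int_vec:
  assumes "1 \<le> n"
  shows "(int_vec n h, int_vec n g) \<in> trop_rel n \<longleftrightarrow> (\<exists>k::int. \<forall>i<n. g i = h i + k)"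
proof
  assume "(int_vec n h, int_vec n g) \<in> trop_rel n"
  then obtain c :: real where c: "\<And>i. i < n \<Longrightarrow> of_int (g i) = c + of_int (h i)"
    by (auto simp: trop_rel_def)
  \<comment> \<open>The real translation is read off at coordinate 0, which exists by
    \<open>1 \<le> n\<close>, and is therefore an integer.\<close>
  have "g i = h i + (g 0 - h 0)" if "i < n" for i
  proof -
    have "real_of_int (g i) = of_int (h i + (g 0 - h 0))"
      using c[OF that] c[of 0] assms by simp
    then show ?thesis by (simp only: of_int_eq_iff)
  qed
  then show "\<exists>k. \<forall>i<n. g i = h i + k" by blast
next
  assume "\<exists>k. \<forall>i<n. g i = h i + k"
  then obtain k where "\<forall>i<n. g i = h i + k" ..
  then show "(int_vec n h, int_vec n g) \<in> trop_rel n"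
    using int_vec_in_trop_vectors[OF assms] by (auto simp: trop_rel_def intro!: exI[of _ "of_int k"])
qed

lemma sym_trop_rel: "sym (trop_rel n)"
proof (rule symI)
  fix x y assume "(x, y) \<in> trop_rel n"
  then obtain c :: real where xy: "x \<in> trop_vectors n" "y \<in> trop_vectors n"
    and c: "\<And>i. i < n \<Longrightarrow> y i = ereal c + x i"
    by (auto simp: trop_rel_def)
  have "x i = ereal (- c) + y i" if "i < n" for i
    by (cases "x i") (auto simp: c[OF that])
  then show "(y, x) \<in> trop_rel n" using xy by (auto simp: trop_rel_def)
qed

lemma trans_trop_rel: "trans (trop_rel n)"
proof (rule transI)
  fix x y z assume "(x, y) \<in> trop_rel n" "(y, z) \<in> trop_rel n"
  then obtain c d :: real where xyz: "x \<in> trop_vectors n" "z \<in> trop_vectors n"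
    and c: "\<And>i. i < n \<Longrightarrow> y i = ereal c + x i" "\<And>i. i < n \<Longrightarrow> z i = ereal d + y i"
    by (auto simp: trop_rel_def)
  have "z i = ereal (d + c) + x i" if "i < n" for i
    by (cases "x i") (auto simp: c that)
  then show "(x, z) \<in> trop_rel n" using xyz by (auto simp: trop_rel_def)
qed

lemma trop_point_int_vec_eq_iff:
  assumes "1 \<le> n"
  shows "trop_point n (int_vec n h) = trop_point n (int_vec n g) \<longleftrightarrow> (\<exists>k::int. \<forall>i<n. g i = h i + k)"
    (is "?l \<longleftrightarrow> ?r")
proof -
  have "(int_vec n g, int_vec n g) \<in> trop_rel n" unfolding trop_rel_int_vec[OF assms] by auto
  then have "?l \<Longrightarrow> (int_vec n h, int_vec n g) \<in> trop_rel n"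
    unfolding trop_point_def by blast
  moreover have "(int_vec n h, int_vec n g) \<in> trop_rel n \<Longrightarrow> ?l"
    using symD[OF sym_trop_rel[of n]] transD[OF trans_trop_rel[of n]] unfolding trop_point_def by blast
  ultimately show ?thesis unfolding trop_rel_int_vec[OF assms, symmetric] by blast
qed

lemma mem_trop_point_int_vec:
  assumes "x \<in> trop_point n (int_vec n h)"
  obtains c :: real where "\<And>i. i < n \<Longrightarrow> x i = ereal (c + of_int (h i))"
  using assms by (auto simp: trop_point_def trop_rel_def)

lemma trop_point_in_integral_points:
  assumes "1 \<le> n"
  shows "trop_point n (int_vec n h) \<in> integral_points n"
  using int_vec_in_trop_vectors[OF assms] int_vec_in_integer_vectors
  by (auto simp: integral_points_def trop_proj_space_def trop_point_def intro: quotientI)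

lemma trop_dist_eq_1_iff:
  assumes "\<And>i. i < n \<Longrightarrow> x i = ereal (a i)" "\<And>i. i < n \<Longrightarrow> y i = ereal (b i)"
  shows "trop_dist n x y = 1 \<longleftrightarrow>
    (\<exists>i j. i < j \<and> j < n \<and> \<bar>a i - a j + b j - b i\<bar> = 1) \<and>
    (\<forall>i j. i < j \<and> j < n \<longrightarrow> \<bar>a i - a j + b j - b i\<bar> \<le> 1)"
proof -
  let ?S = "{\<bar>x i - x j + y j - y i\<bar> | i j. i < j \<and> j < n}"
  have S: "?S = {ereal \<bar>a i - a j + b j - b i\<bar> | i j. i < j \<and> j < n}"
  proof -
    have "\<bar>x i - x j + y j - y i\<bar> = ereal \<bar>a i - a j + b j - b i\<bar>" if "i < j" "j < n" for i j
      using assms that by simp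
    then show ?thesis by (intro Collect_cong) metis
  qed
  have "finite ?S"
    by (rule finite_subset[of _ "(\<lambda>(i, j). \<bar>x i - x j + y j - y i\<bar>) ` ({..<n} \<times> {..<n})"]) auto
  then have "trop_dist n x y = 1 \<longleftrightarrow> 1 \<in> insert 0 ?S \<and> (\<forall>t\<in>insert 0 ?S. t \<le> 1)"
    unfolding trop_dist_def by (subst Max_eq_iff) auto
  moreover have "(1 :: ereal) \<in> insert 0 {ereal \<bar>a i - a j + b j - b i\<bar> | i j. i < j \<and> j < n} \<longleftrightarrow>
      (\<exists>i j. i < j \<and> j < n \<and> \<bar>a i - a j + b j - b i\<bar> = 1)"
    by (auto simp: one_ereal_def)
  moreover have "(\<forall>t\<in>insert 0 {ereal \<bar>a i - a j + b j - b i\<bar> | i j. i < j \<and> j < n}. t \<le> 1) \<longleftrightarrow>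
      (\<forall>i j. i < j \<and> j < n \<longrightarrow> ereal \<bar>a i - a j + b j - b i\<bar> \<le> 1)"
    (is "(\<forall>t\<in>insert 0 ?T. t \<le> 1) \<longleftrightarrow> ?r")
  proof
    assume *: "\<forall>t\<in>insert 0 ?T. t \<le> 1"
    show ?r
    proof (intro allI impI)
      fix i j assume "i < j \<and> j < n"
      then have "ereal \<bar>a i - a j + b j - b i\<bar> \<in> insert 0 ?T" by blast
      with * show "ereal \<bar>a i - a j + b j - b i\<bar> \<le> 1" by (rule bspec)
    qed
  qed auto
  ultimately show ?thesis unfolding S by (simp add: one_ereal_def)
qed

text \<open>The entries of \<open>h - g\<close> are integers at mutual distance at most 1, not all
  equal, hence take two consecutive values. In terms of levels this is the chain of inclusions that
  defines adjacent lattice classes.\<close>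

lemma trop_adjacent_int_vec_iff:
  fixes h g :: "nat \<Rightarrow> int"
  assumes "1 \<le> n"
  shows "trop_adjacent n (trop_point n (int_vec n h)) (trop_point n (int_vec n g)) \<longleftrightarrow>
    (\<exists>k. \<forall>i<n. h i - g i = k \<or> h i - g i = k + 1) \<and> (\<exists>i<n. \<exists>j<n. h i - g i \<noteq> h j - g j)"
    (is "?l \<longleftrightarrow> ?r")
proof
  assume ?l
  then obtain x y where x: "x \<in> trop_point n (int_vec n h)" and y: "y \<in> trop_point n (int_vec n g)"
    and dist: "trop_dist n x y = 1"
    unfolding trop_adjacent_def by blast
  obtain c where c: "\<And>i. i < n \<Longrightarrow> x i = ereal (c + of_int (h i))"
    using x by (elim mem_trop_point_int_vec) blast
  obtain d where d: "\<And>i. i < n \<Longrightarrow> y i = ereal (d + of_int (g i))"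
    using y by (elim mem_trop_point_int_vec) blast
  define \<delta> where "\<delta> i = h i - g i" for i
  have diff: "\<bar>(c + of_int (h i)) - (c + of_int (h j)) + (d + of_int (g j)) - (d + of_int (g i))\<bar> =
      real_of_int \<bar>\<delta> i - \<delta> j\<bar>" for i j
    by (simp add: \<delta>_def algebra_simps)
  have "(\<exists>i j. i < j \<and> j < n \<and> real_of_int \<bar>\<delta> i - \<delta> j\<bar> = 1) \<and>
      (\<forall>i j. i < j \<and> j < n \<longrightarrow> real_of_int \<bar>\<delta> i - \<delta> j\<bar> \<le> 1)"
    using dist trop_dist_eq_1_iff[of n x "\<lambda>i. c + of_int (h i)" y "\<lambda>i. d + of_int (g i)"] c d
    unfolding diff by blast
  then obtain i j where ij: "i < j" "j < n" "\<bar>\<delta> i - \<delta> j\<bar> = 1"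
    and less: "\<And>i j. i < j \<Longrightarrow> j < n \<Longrightarrow> \<bar>\<delta> i - \<delta> j\<bar> \<le> 1"
    by (auto simp del: of_int_abs of_int_diff)
  have le: "\<bar>\<delta> i - \<delta> j\<bar> \<le> 1" if "i < n" "j < n" for i j
    using that less[of i j] less[of j i] by (cases i j rule: linorder_cases) auto
  have "\<forall>l<n. \<delta> l = min (\<delta> i) (\<delta> j) \<or> \<delta> l = min (\<delta> i) (\<delta> j) + 1"
  proof (intro allI impI)
    fix l assume "l < n"
    then show "\<delta> l = min (\<delta> i) (\<delta> j) \<or> \<delta> l = min (\<delta> i) (\<delta> j) + 1"
      using le[of l i] le[of l j] ij by linarith
  qed
  moreover have "i < n" "\<delta> i \<noteq> \<delta> j" using ij by auto
  ultimately show ?r using ij(2) unfolding \<delta>_def by blast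
next
  assume ?r
  then obtain k i j where k: "\<And>i. i < n \<Longrightarrow> h i - g i = k \<or> h i - g i = k + 1"
    and ij: "i < n" "j < n" "h i - g i \<noteq> h j - g j" by blast
  have diff: "\<bar>real_of_int (h i) - of_int (h j) + of_int (g j) - of_int (g i)\<bar> =
      real_of_int \<bar>(h i - g i) - (h j - g j)\<bar>" for i j
    by simp
  have "\<exists>i j. i < j \<and> j < n \<and> \<bar>(h i - g i) - (h j - g j)\<bar> = 1"
  proof (cases "i < j")
    case True
    then show ?thesis using k[of i] k[of j] ij by (intro exI[of _ i] exI[of _ j]) auto
  next
    case False
    then have "j < i" using ij by (cases "i = j") auto
    then show ?thesis using k[of i] k[of j] ij by (intro exI[of _ j] exI[of _ i]) auto
  qed
  moreover have "\<bar>(h i - g i) - (h j - g j)\<bar> \<le> 1" if "i < n" "j < n" for i j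
    using k[OF that(1)] k[OF that(2)] by auto
  ultimately have "trop_dist n (int_vec n h) (int_vec n g) = 1"
    by (subst trop_dist_eq_1_iff[of n _ "\<lambda>i. of_int (h i)" _ "\<lambda>i. of_int (g i)"])
      (auto simp: diff simp del: of_int_abs of_int_diff)
  moreover have "int_vec n h \<in> trop_point n (int_vec n h)" for h
    using trop_rel_int_vec[OF assms, of h h] by (auto simp: trop_point_def)
  ultimately show ?l unfolding trop_adjacent_def by blast
qed

lemma trop_combination_int_vec:
  assumes "1 \<le> m"
  shows "trop_combination n m (\<lambda>k. ereal (of_int (c k))) (\<lambda>k. int_vec n (q k)) =
    int_vec n (\<lambda>i. Min ((\<lambda>k. c k + q k i) ` {..<m}))"
proof -
  have "mono (\<lambda>z::int. ereal (of_int z))" by (auto intro: monoI)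
  from mono_Min_commute[OF this, of "(\<lambda>k. c k + q k i) ` {..<m}" for i]
  have "Min ((\<lambda>k. ereal (of_int (c k)) + ereal (of_int (q k i))) ` {..<m}) =
      ereal (of_int (Min ((\<lambda>k. c k + q k i) ` {..<m})))" for i
    using assms by (simp add: image_image lessThan_empty_iff)
  then show ?thesis
    unfolding trop_combination_def int_vec_def by (intro restrict_ext) simp
qed

text \<open>
  Residuation: an integral combination stays unchanged when each coefficient is lowered to the
  least possible one, which is an integer.
\<close>

lemma integral_points_trop_polytope:
  assumes n: "1 \<le> n" and m: "1 \<le> m"
  shows "integral_points n \<inter> trop_polytope n m (\<lambda>k. int_vec n (q k)) =
    range (\<lambda>c. trop_point n (int_vec n (\<lambda>i. Min ((\<lambda>k. c k + q k i) ` {..<m}))))"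
proof (intro equalityI subsetI)
  fix X assume "X \<in> range (\<lambda>c. trop_point n (int_vec n (\<lambda>i. Min ((\<lambda>k. c k + q k i) ` {..<m}))))"
  then obtain c where X: "X = trop_point n (int_vec n (\<lambda>i. Min ((\<lambda>k. c k + q k i) ` {..<m})))" by blast
  then have "X = trop_point n (trop_combination n m (\<lambda>k. ereal (of_int (c k))) (\<lambda>k. int_vec n (q k)))"
    by (simp add: trop_combination_int_vec[OF m])
  then have "X \<in> trop_polytope n m (\<lambda>k. int_vec n (q k))"
    unfolding trop_polytope_def using m
    by (intro CollectI exI[of _ "\<lambda>k. ereal (of_int (c k))"]) (auto intro: exI[of _ 0])
  then show "X \<in> integral_points n \<inter> trop_polytope n m (\<lambda>k. int_vec n (q k))"
    using trop_point_in_integral_points[OF n] X by simp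
next
  fix X assume X: "X \<in> integral_points n \<inter> trop_polytope n m (\<lambda>k. int_vec n (q k))"
  then obtain h where h: "X = trop_point n (int_vec n h)"
    by (auto simp: integral_points_def elim: integer_vector_eq_int_vec)
  obtain c where c: "X = trop_point n (trop_combination n m c (\<lambda>k. int_vec n (q k)))"
    using X by (auto simp: trop_polytope_def)
  let ?x = "trop_combination n m c (\<lambda>k. int_vec n (q k))"
  have "(int_vec n h, int_vec n h) \<in> trop_rel n" unfolding trop_rel_int_vec[OF n] by auto
  then have "int_vec n h \<in> X" by (simp add: h trop_point_def)
  then have "(?x, int_vec n h) \<in> trop_rel n" by (simp add: c trop_point_def)
  then obtain r :: real where r: "\<And>i. i < n \<Longrightarrow> ereal (of_int (h i)) = ereal r + ?x i"
    by (auto simp: trop_rel_def)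
  have x: "?x i = Min ((\<lambda>k. c k + ereal (of_int (q k i))) ` {..<m})" if "i < n" for i
    using that by (simp add: trop_combination_def)
  have x_eq: "?x i = ereal (of_int (h i) - r)" if "i < n" for i
    using r[OF that] by (cases "?x i") auto
  \<comment> \<open>\<open>C k\<close> is the least coefficient for which \<open>C k + q k i\<close>
    stays above \<open>h i\<close> at all coordinates.\<close>
  define C where "C k = Max ((\<lambda>i. h i - q k i) ` {..<n})" for k
  have "h i = Min ((\<lambda>k. C k + q k i) ` {..<m})" if i: "i < n" for i
  proof (rule Min_eqI[symmetric])
    show "finite ((\<lambda>k. C k + q k i) ` {..<m})" by simp
    fix z assume "z \<in> (\<lambda>k. C k + q k i) ` {..<m}"
    then obtain k where k: "z = C k + q k i" by blast
    have "h i - q k i \<le> C k" unfolding C_def using i by (intro Max_ge) auto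
    then show "h i \<le> z" using k by simp
  next
    \<comment> \<open>Let \<open>k\<close> attain the minimum at coordinate \<open>i\<close>. The
      real number \<open>\<gamma> + r\<close> bounds all differences \<open>h l - q k l\<close> and
      equals the one at \<open>i\<close>. So the maximum \<open>C k\<close> is attained at
      \<open>i\<close>, and \<open>C\<close> reproduces \<open>h i\<close>.\<close>
    have "Min ((\<lambda>k. c k + ereal (of_int (q k i))) ` {..<m}) \<in> (\<lambda>k. c k + ereal (of_int (q k i))) ` {..<m}"
      using m by (intro Min_in) (auto simp: lessThan_empty_iff)
    then obtain k where k: "k < m" "ereal (of_int (h i) - r) = c k + ereal (of_int (q k i))"
      using x[OF i] x_eq[OF i] by auto
    then obtain \<gamma> where \<gamma>: "c k = ereal \<gamma>" by (cases "c k") auto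
    have le: "of_int (h l - q k l) \<le> \<gamma> + r" if "l < n" for l
    proof -
      have "?x l \<le> c k + ereal (of_int (q k l))"
        unfolding x[OF that] using k(1) by (intro Min_le) auto
      then show ?thesis unfolding x_eq[OF that] \<gamma> by simp
    qed
    have "C k \<in> (\<lambda>i. h i - q k i) ` {..<n}"
      unfolding C_def using i by (intro Max_in) auto
    then obtain l where "C k = h l - q k l" "l < n" by blast
    then have "of_int (C k) \<le> \<gamma> + r" using le by simp
    moreover have "\<gamma> + r = of_int (h i - q k i)" using k(2) \<gamma> by simp
    ultimately have "C k \<le> h i - q k i" by (simp only: of_int_le_iff)
    moreover have "h i - q k i \<le> C k" unfolding C_def using i by (intro Max_ge) auto
    ultimately have "h i = C k + q k i" by simp
    then show "h i \<in> (\<lambda>k. C k + q k i) ` {..<m}" using k(1) by blast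
  qed
  then have "int_vec n h = int_vec n (\<lambda>i. Min ((\<lambda>k. C k + q k i) ` {..<m}))"
    unfolding int_vec_def by (intro restrict_ext) simp
  then show "X \<in> range (\<lambda>c. trop_point n (int_vec n (\<lambda>i. Min ((\<lambda>k. c k + q k i) ` {..<m}))))"
    unfolding h by (intro range_eqI[of _ _ C]) simp
qed

lemma trop_lattice_polytope_int_vec:
  "1 \<le> m \<Longrightarrow> trop_lattice_polytope n (trop_polytope n m (\<lambda>k. int_vec n (q k)))"
  unfolding trop_lattice_polytope_def using int_vec_in_integer_vectors
  by (intro exI[of _ m] exI[of _ "\<lambda>k. int_vec n (q k)"]) simp

section \<open>The isomorphism\<close>

lemma (in uniformized_valuation) conv_complex_isomorphic_trop_polytope:
  fixes A :: "nat \<Rightarrow> 'k ^ 'd ^ 'd"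
  assumes s: "1 \<le> s" and A: "\<And>i. i \<in> {1..s} \<Longrightarrow> invertible (A i)"
    and X: "finite X" "X \<noteq> {}" "0 \<notin> X" and span: "\<And>a. spanning X (inter {1..s} A a)"
  shows "\<exists>P. trop_lattice_polytope (card X) P \<and>
    simplicial_isomorphic (conv_complex v \<pi> ((\<lambda>i. box (A i) (\<lambda>_. 0)) ` {1..s}))
      (induced_subcomplex (standard_triangulation (card X)) P)"
proof -
  define n where "n = card X"
  have n: "1 \<le> n" unfolding n_def using X by (simp add: Suc_le_eq card_gt_0_iff)
  obtain f where f: "bij_betw f {0..<n} X"
    using ex_bij_betw_nat_finite[OF X(1)] unfolding n_def by blast
  have f0: "f i \<noteq> 0" if "i < n" for i using f X(3) that by (auto simp: bij_betw_def)
  have all_X: "(\<forall>g\<in>X. Q g) \<longleftrightarrow> (\<forall>i<n. Q (f i))" for Q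
    using f by (auto simp: bij_betw_def)
  let ?L = "inter {1..s} A"
  have lat: "is_lattice v (?L a)" for a
    using is_lattice_inter[of "{1..s}" 1 A] A s by simp
  define H where "H a i = level (?L a) (f i)" for a i
  have H_shift: "H (\<lambda>j. a j + k) i = H a i - k" if "i < n" for a k i
    using level_shift[OF lat f0[OF that], of k a] by (simp add: H_def shift_inter)
  have subset: "?L a \<subseteq> ?L b \<longleftrightarrow> (\<forall>i<n. H a i \<le> H b i)" for a b
    unfolding subset_iff_level_le[OF lat lat span X(3)] all_X H_def ..
  have class_eq: "lattice_class v (?L a) = lattice_class v (?L b) \<longleftrightarrow> (\<exists>k. \<forall>i<n. H b i = H a i + k)" for a b
  proof -
    have "?L b = shift k (?L a) \<longleftrightarrow> (\<forall>i<n. H b i = H a i - k)" for k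
      unfolding shift_inter set_eq_subset subset by (auto simp: H_shift intro: order_antisym)
    then have "lattice_class v (?L a) = lattice_class v (?L b) \<longleftrightarrow> (\<exists>k. \<forall>i<n. H b i = H a i - k)"
      unfolding lattice_class_eq_iff[OF lat lat] by simp
    also have "\<dots> \<longleftrightarrow> (\<exists>k. \<forall>i<n. H b i = H a i + k)"
      by (metis diff_minus_eq_add add_uminus_conv_diff)
    finally show ?thesis .
  qed
  \<comment> \<open>The lattices are numbered from 1 and the tropical generators from 0. A shift by
    \<open>a (Suc k)\<close> will enter as the tropical coefficient
    \<open>- a (Suc k)\<close>.\<close>
  define q where "q k i = level (box (A (Suc k)) (\<lambda>_. 0)) (f i)" for k i
  define P where "P = trop_polytope n s (\<lambda>k. int_vec n (q k))"
  have H_Min: "H a i = Min ((\<lambda>k. - a (Suc k) + q k i) ` {..<s})" if "i < n" for a i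
  proof -
    have "H a i = Min ((\<lambda>i'. level (box (A i') (\<lambda>_. 0)) (f i) - a i') ` {1..s})"
      unfolding H_def using s A f0[OF that] by (intro level_inter) auto
    also have "{1..s} = Suc ` {..<s}" by (simp add: image_Suc_lessThan)
    finally show ?thesis by (simp add: image_image q_def)
  qed
  define W where "W = lattice_conv v ((\<lambda>i. box (A i) (\<lambda>_. 0)) ` {1..s})"
  have W: "W = range (\<lambda>a. lattice_class v (?L a))"
    unfolding W_def using s A by (intro lattice_conv_eq) auto
  then have VW: "lattice_classes v \<inter> W = W"
    using lattice_class_in_lattice_classes[OF lat] by blast
  have target: "integral_points n \<inter> P = range (\<lambda>a. trop_point n (int_vec n (H a)))"
  proof -
    let ?G = "\<lambda>c. int_vec n (\<lambda>i. Min ((\<lambda>k. c k + q k i) ` {..<s}))"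
    have G: "?G c = int_vec n (H (\<lambda>j. - c (j - 1)))" for c
      unfolding int_vec_def by (intro restrict_ext) (simp add: H_Min)
    have *: "trop_point n (?G c) \<in> range (\<lambda>a. trop_point n (int_vec n (H a)))" for c
      unfolding G by (rule rangeI)
    have HG: "int_vec n (H a) = ?G (\<lambda>k. - a (Suc k))" for a
      unfolding int_vec_def by (intro restrict_ext) (simp add: H_Min)
    have "trop_point n (int_vec n (H a)) \<in> range (\<lambda>c. trop_point n (?G c))" for a
      unfolding HG by (rule rangeI)
    with * show ?thesis
      unfolding P_def integral_points_trop_polytope[OF n s] by (intro equalityI image_subsetI)
  qed
  \<comment> \<open>The representative is arbitrary: another one is a shift, which translates all
    levels by the same integer and leaves the tropical point unchanged.\<close>
  define \<phi> where "\<phi> C = trop_point n (int_vec n (\<lambda>i. level (SOME L. L \<in> C) (f i)))" for C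
  have \<phi>: "\<phi> (lattice_class v (?L a)) = trop_point n (int_vec n (H a))" for a
  proof -
    have "(SOME L. L \<in> lattice_class v (?L a)) \<in> lattice_class v (?L a)"
      unfolding lattice_class_eq_shifts[OF lat] by (rule someI_ex) blast
    then obtain k where k: "(SOME L. L \<in> lattice_class v (?L a)) = shift k (?L a)"
      unfolding lattice_class_eq_shifts[OF lat] by blast
    have "\<forall>i<n. H a i = level (SOME L. L \<in> lattice_class v (?L a)) (f i) + k"
      unfolding k by (simp add: H_def level_shift[OF lat f0] del: One_nat_def)
    then show ?thesis unfolding \<phi>_def trop_point_int_vec_eq_iff[OF n] by blast
  qed
  have "bij_betw \<phi> W (integral_points n \<inter> P)"
    unfolding bij_betw_def
  proof
    show "inj_on \<phi> W"
    proof (rule inj_onI)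
      fix C D assume "C \<in> W" "D \<in> W" and eq: "\<phi> C = \<phi> D"
      then obtain a b where ab: "C = lattice_class v (?L a)" "D = lattice_class v (?L b)"
        unfolding W by blast
      show "C = D" using eq unfolding ab \<phi> class_eq trop_point_int_vec_eq_iff[OF n] .
    qed
    show "\<phi> ` W = integral_points n \<inter> P"
      unfolding W target by (simp add: image_image \<phi> del: One_nat_def)
  qed
  moreover have "adjacent_classes \<pi> C D \<longleftrightarrow> trop_adjacent n (\<phi> C) (\<phi> D)"
    if CD: "C \<in> W" "D \<in> W" "C \<noteq> D" for C D
  proof -
    obtain a b where ab: "C = lattice_class v (?L a)" "D = lattice_class v (?L b)"
      using CD(1,2) unfolding W by blast
    have "adjacent_classes \<pi> C D \<longleftrightarrow>
        (\<exists>k l. shift 1 (shift k (?L a)) \<subseteq> shift l (?L b) \<and> shift l (?L b) \<subseteq> shift k (?L a))"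
      using CD(3) unfolding adjacent_classes_def scale_set_uniformizer ab lattice_class_eq_shifts[OF lat]
      by blast
    also have "\<dots> \<longleftrightarrow> (\<exists>k l. \<forall>i<n. H a i - (1 + k) \<le> H b i - l \<and> H b i - l \<le> H a i - k)"
    proof -
      have "shift 1 (shift k (?L a)) \<subseteq> shift l (?L b) \<and> shift l (?L b) \<subseteq> shift k (?L a) \<longleftrightarrow>
          (\<forall>i<n. H a i - (1 + k) \<le> H b i - l \<and> H b i - l \<le> H a i - k)" for k l
        unfolding shift_shift shift_inter subset by (auto simp: H_shift)
      then show ?thesis by simp
    qed
    \<comment> \<open>The inequalities say that \<open>H a i - H b i\<close> lies between
      \<open>k - l\<close> and \<open>k - l + 1\<close>. Only \<open>k - l\<close> matters, so
      \<open>l = 0\<close> suffices in the converse.\<close>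
    also have "\<dots> \<longleftrightarrow> (\<exists>m. \<forall>i<n. H a i - H b i = m \<or> H a i - H b i = m + 1)"
    proof
      assume "\<exists>k l. \<forall>i<n. H a i - (1 + k) \<le> H b i - l \<and> H b i - l \<le> H a i - k"
      then obtain k l where "\<forall>i<n. H a i - (1 + k) \<le> H b i - l \<and> H b i - l \<le> H a i - k" by blast
      then have "\<forall>i<n. H a i - H b i = k - l \<or> H a i - H b i = k - l + 1" by (smt (verit))
      then show "\<exists>m. \<forall>i<n. H a i - H b i = m \<or> H a i - H b i = m + 1" by blast
    next
      assume "\<exists>m. \<forall>i<n. H a i - H b i = m \<or> H a i - H b i = m + 1"
      then obtain m where "\<forall>i<n. H a i - H b i = m \<or> H a i - H b i = m + 1" by blast
      then have "\<forall>i<n. H a i - (1 + m) \<le> H b i - 0 \<and> H b i - 0 \<le> H a i - m" by (smt (verit))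
      then show "\<exists>k l. \<forall>i<n. H a i - (1 + k) \<le> H b i - l \<and> H b i - l \<le> H a i - k" by blast
    qed
    also have "\<dots> \<longleftrightarrow> trop_adjacent n (\<phi> C) (\<phi> D)"
    proof -
      \<comment> \<open>If all differences agreed, the two level vectors would be translates of each
        other and the classes would coincide.\<close>
      have "\<exists>i<n. \<exists>j<n. H a i - H b i \<noteq> H a j - H b j"
      proof (rule ccontr)
        assume *: "\<not> (\<exists>i<n. \<exists>j<n. H a i - H b i \<noteq> H a j - H b j)"
        have "H b i = H a i + (H b 0 - H a 0)" if "i < n" for i
        proof -
          have "0 < n" using n by simp
          then have "H a i - H b i = H a 0 - H b 0" using * that by blast
          then show ?thesis by simp
        qed
        then have "C = D" unfolding ab class_eq by blast
        then show False using CD(3) by simp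
      qed
      then show ?thesis unfolding ab \<phi> trop_adjacent_int_vec_iff[OF n] by simp
    qed
    finally show ?thesis .
  qed
  ultimately have "simplicial_isomorphic (induced_subcomplex (flag_complex (lattice_classes v) (adjacent_classes \<pi>)) W)
      (induced_subcomplex (flag_complex (integral_points n) (trop_adjacent n)) P)"
    by (intro simplicial_isomorphic_induced_flag[where f = \<phi>]) (auto simp: VW)
  then have "simplicial_isomorphic (conv_complex v \<pi> ((\<lambda>i. box (A i) (\<lambda>_. 0)) ` {1..s}))
      (induced_subcomplex (standard_triangulation n) P)"
    unfolding conv_complex_def affine_building_def standard_triangulation_def W_def .
  moreover have "trop_lattice_polytope n P"
    unfolding P_def using s by (rule trop_lattice_polytope_int_vec)
  ultimately show ?thesis unfolding n_def by blast
qed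

theorem corollary4p5:
  fixes v :: "'k::field \<Rightarrow> ereal" and \<pi> :: 'k
    and \<Lambda> :: "nat \<Rightarrow> ('k ^ 'd) set" and s :: nat
  assumes "discrete_valuation v" and "uniformizer v \<pi>"
    and "1 \<le> s" and "\<And>i. i \<in> {1..s} \<Longrightarrow> is_lattice v (\<Lambda> i)"
  shows "\<exists>N P. (3 \<le> s \<longrightarrow> int N \<le> int CARD('d) * 2 ^ CARD('d) * fact CARD('d) ^ (s - 3) - 1) \<and>
           trop_lattice_polytope (N + 1) P \<and>
           simplicial_isomorphic (conv_complex v \<pi> (\<Lambda> ` {1..s}))
             (induced_subcomplex (standard_triangulation (N + 1)) P)"
proof -
  interpret uniformized_valuation v \<pi> using assms(1,2) by unfold_locales
  text \<open>For fewer than three lattices no bound is claimed, so the family may be padded with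
    copies of the first one.\<close>
  define t where "t = max s 3"
  define \<Lambda>' where "\<Lambda>' i = (if i \<le> s then \<Lambda> i else \<Lambda> 1)" for i
  have t: "3 \<le> t" "1 \<le> t" by (auto simp: t_def)
  have image: "\<Lambda> ` {1..s} = \<Lambda>' ` {1..t}"
  proof (intro equalityI subsetI)
    fix L assume "L \<in> \<Lambda> ` {1..s}"
    then obtain i where "i \<in> {1..s}" "L = \<Lambda> i" by blast
    then have "L = \<Lambda>' i" "i \<in> {1..t}" by (auto simp: \<Lambda>'_def t_def)
    then show "L \<in> \<Lambda>' ` {1..t}" by blast
  next
    fix L assume "L \<in> \<Lambda>' ` {1..t}"
    then show "L \<in> \<Lambda> ` {1..s}" using assms(3) by (auto simp: \<Lambda>'_def)
  qed
  have "is_lattice v (\<Lambda>' i)" if "i \<in> {1..t}" for i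
    using assms(3,4) that by (auto simp: \<Lambda>'_def)
  then obtain A X where A: "\<And>i. i \<in> {1..t} \<Longrightarrow> invertible (A i) \<and> \<Lambda>' i = box (A i) (\<lambda>_. 0)"
    and X: "finite X" "X \<noteq> {}" "0 \<notin> X"
    and card_X: "card X \<le> CARD('d) * 2 ^ CARD('d) * fact CARD('d) ^ (t - 3)"
    and span: "\<And>a. spanning X (inter {1..t} A a)"
    using lattices_common_spanning_set[OF t(1), of \<Lambda>'] by blast
  have "\<exists>P. trop_lattice_polytope (card X) P \<and>
    simplicial_isomorphic (conv_complex v \<pi> ((\<lambda>i. box (A i) (\<lambda>_. 0)) ` {1..t}))
      (induced_subcomplex (standard_triangulation (card X)) P)"
    using A by (intro conv_complex_isomorphic_trop_polytope t X span) blast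
  moreover have "(\<lambda>i. box (A i) (\<lambda>_. 0)) ` {1..t} = \<Lambda> ` {1..s}"
    unfolding image using A by (intro image_cong) auto
  \<comment> \<open>The dimension \<open>N\<close> is \<open>card X - 1\<close>, one less than the
    number of homogeneous coordinates. As \<open>X\<close> is nonempty, the subtraction of natural
    numbers is exact.\<close>
  moreover have "card X - 1 + 1 = card X" using X by (simp add: Suc_le_eq card_gt_0_iff)
  moreover have "int (card X - 1) \<le> int CARD('d) * 2 ^ CARD('d) * fact CARD('d) ^ (s - 3) - 1" if "3 \<le> s"
  proof -
    have "int (card X) \<le> int (CARD('d) * 2 ^ CARD('d) * fact CARD('d) ^ (t - 3))"
      using card_X by (simp only: of_nat_le_iff)
    also have "t = s" using that by (simp add: t_def)
    finally show ?thesis using X by (simp add: of_nat_diff Suc_le_eq card_gt_0_iff)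
  qed
  ultimately show ?thesis by metis
qed

end
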